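(* If $\psi:\mathfrak{sv}^+\to\mathbb{C}$ is identically zero, then the set of Whittaker vectors of $W_\psi$ (that is, of $v\in W_\psi$ with $xv=\psi(x)v=0$ for all $x\in\mathfrak{sv}^+$) is $\mathbb{C}[L_0,M_0]w$, where $w=1\otimes 1$.
   Context: The Schrödinger-Virasoro algebra $\mathfrak{sv}$ is the complex Lie algebra with basis $\{L_n,M_n,Y_{n+\frac12}\mid n\in\mathbb{Z}\}$ and brackets, for $m,n\in\mathbb{Z}$: $[L_m,L_n]=(n-m)L_{m+n}$, $[L_m,M_n]=nM_{m+n}$, $[L_m,Y_{n+\frac12}]=(n+\frac{1-m}{2})Y_{m+n+\frac12}$, $[Y_{m+\frac12},Y_{n+\frac12}]=(n-m)M_{m+n+1}$, $[M_m,M_n]=[M_m,Y_{n+\frac12}]=0$. Put $\mathfrak{sv}^+=\mathrm{span}_{\mathbb{C}}\{L_n,M_n,Y_{m+\frac12}\mid n\geq 1,\ m\geq 0\}$. For a Lie algebra homomorphism $\psi:\mathfrak{sv}^+\to\mathbb{C}$ let $\mathbb{C}_\psi$ be the one-dimensional $\mathfrak{sv}^+$-module with $x\alpha=\psi(x)\alpha$, and let $W_\psi=U(\mathfrak{sv})\otimes_{U(\mathfrak{sv}^+)}\mathbb{C}_\psi$. $\mathbb{C}[L_0,M_0]$ denotes the (commutative polynomial) subalgebra of $U(\mathfrak{sv})$ generated by $L_0$ and $M_0$. *)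

theory Defs
  imports Complex_Main "HOL-Library.Poly_Mapping"
begin

section \<open>Complex vector spaces, associative algebras and Lie algebras\<close>

class complex_vec = ab_group_add +
  fixes cscale :: "complex \<Rightarrow> 'a \<Rightarrow> 'a"
  assumes cscale_add_right: "cscale c (x + y) = cscale c x + cscale c y"
    and cscale_add_left: "cscale (c + d) x = cscale c x + cscale d x"
    and cscale_cscale: "cscale c (cscale d x) = cscale (c * d) x"
    and cscale_one: "cscale 1 x = x"

global_interpretation cvec: vector_space "cscale :: complex \<Rightarrow> 'a \<Rightarrow> 'a::complex_vec"
  by standard (simp_all add: cscale_add_right cscale_add_left cscale_cscale cscale_one)

abbreviation clinear :: "('a::complex_vec \<Rightarrow> 'b::complex_vec) \<Rightarrow> bool"
  where "clinear \<equiv> Vector_Spaces.linear cscale cscale"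

lemma clinearI:
  assumes "\<And>x y. f (x + y) = f x + f y" and "\<And>c x. f (cscale c x) = cscale c (f x)"
  shows "clinear f"
  using assms by unfold_locales auto

lemma clinear_add: "clinear f \<Longrightarrow> f (x + y) = f x + f y"
  by (rule Vector_Spaces.linear.axioms(3)[THEN module_hom.add])

lemma clinear_cscale: "clinear f \<Longrightarrow> f (cscale c x) = cscale c (f x)"
  by (rule Vector_Spaces.linear.axioms(3)[THEN module_hom.scale])

lemma clinear_diff: "clinear f \<Longrightarrow> f (x - y) = f x - f y"
  by (rule Vector_Spaces.linear.axioms(3)[THEN module_hom.diff])

lemma clinear_zero: "clinear f \<Longrightarrow> f 0 = 0"
  by (rule Vector_Spaces.linear.axioms(3)[THEN module_hom.zero])

lemma clinear_sum: "clinear f \<Longrightarrow> f (\<Sum>i\<in>A. g i) = (\<Sum>i\<in>A. f (g i))"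
  by (rule Vector_Spaces.linear.axioms(3)[THEN module_hom.sum])

lemma clinear_minus: "clinear f \<Longrightarrow> f (- x) = - f x"
  by (rule Vector_Spaces.linear.axioms(3)[THEN module_hom.neg])

class complex_alg = complex_vec + ring_1 +
  assumes cscale_mult_left: "cscale c x * y = cscale c (x * y)"
    and cscale_mult_right: "x * cscale c y = cscale c (x * y)"

class complex_lie = complex_vec +
  fixes lie_bracket :: "'a \<Rightarrow> 'a \<Rightarrow> 'a"
  assumes lie_add_left: "lie_bracket (x + y) z = lie_bracket x z + lie_bracket y z"
    and lie_add_right: "lie_bracket x (y + z) = lie_bracket x y + lie_bracket x z"
    and lie_scale_left: "lie_bracket (cscale c x) y = cscale c (lie_bracket x y)"
    and lie_scale_right: "lie_bracket x (cscale c y) = cscale c (lie_bracket x y)"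
    and lie_self: "lie_bracket x x = 0"
    and lie_jacobi: "lie_bracket x (lie_bracket y z) + lie_bracket y (lie_bracket z x)
          + lie_bracket z (lie_bracket x y) = 0"

definition lie_hom :: "('a::complex_lie \<Rightarrow> 'b::complex_lie) \<Rightarrow> bool"
  where "lie_hom f \<longleftrightarrow> clinear f \<and> (\<forall>x y. f (lie_bracket x y) = lie_bracket (f x) (f y))"

instantiation complex :: "{complex_alg, complex_lie}"
begin
definition cscale_complex :: "complex \<Rightarrow> complex \<Rightarrow> complex"
  where "cscale_complex c x = c * x"
definition lie_bracket_complex :: "complex \<Rightarrow> complex \<Rightarrow> complex"
  where "lie_bracket_complex x y = 0"
instance
  by standard (simp_all add: cscale_complex_def lie_bracket_complex_def algebra_simps)
end

definition complex_subalgebra :: "'a::complex_alg set \<Rightarrow> bool"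
  where "complex_subalgebra A \<longleftrightarrow> 1 \<in> A \<and> (\<forall>x\<in>A. \<forall>y\<in>A. x + y \<in> A \<and> x * y \<in> A)
    \<and> (\<forall>c. \<forall>x\<in>A. cscale c x \<in> A)"

definition two_sided_ideal :: "'a::ring_1 set \<Rightarrow> bool"
  where "two_sided_ideal I \<longleftrightarrow> 0 \<in> I \<and> (\<forall>x\<in>I. \<forall>y\<in>I. x + y \<in> I)
    \<and> (\<forall>a. \<forall>x\<in>I. a * x \<in> I \<and> x * a \<in> I)"

definition additive_subgroup :: "'a::ab_group_add set \<Rightarrow> bool"
  where "additive_subgroup N \<longleftrightarrow> 0 \<in> N \<and> (\<forall>x\<in>N. \<forall>y\<in>N. x - y \<in> N)"

lemma two_sided_ideal_hull: "two_sided_ideal (two_sided_ideal hull S)"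
  by (rule hull_in) (auto simp: two_sided_ideal_def)

lemma additive_subgroup_hull: "additive_subgroup (additive_subgroup hull S)"
  by (rule hull_in) (auto simp: additive_subgroup_def)


section \<open>The free associative algebra\<close>

text \<open>Words, with concatenation written additively: \<^typ>\<open>'k \<Rightarrow>\<^sub>0 'b\<close> carries
  the convolution product for key types in \<^class>\<open>monoid_add\<close>, so
  \<open>'a word \<Rightarrow>\<^sub>0 complex\<close> is the free algebra on the set underlying \<^typ>\<open>'a\<close>.\<close>

datatype 'a word = Word (letters: "'a list")

instantiation word :: (type) monoid_add
begin
definition zero_word :: "'a word" where "zero_word = Word []"
definition plus_word :: "'a word \<Rightarrow> 'a word \<Rightarrow> 'a word"
  where "plus_word u v = Word (letters u @ letters v)"
instance by standard (simp_all add: zero_word_def plus_word_def)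
end

instantiation poly_mapping :: (type, complex_vec) complex_vec
begin
lift_definition cscale_poly_mapping :: "complex \<Rightarrow> ('a \<Rightarrow>\<^sub>0 'b) \<Rightarrow> 'a \<Rightarrow>\<^sub>0 'b"
  is "\<lambda>c f k. cscale c (f k)"
  by (erule finite_subset[rotated]) auto
instance
  by standard (transfer; simp add: cscale_add_right cscale_add_left cscale_cscale cscale_one fun_eq_iff)+
end

lemma lookup_cscale: "Poly_Mapping.lookup (cscale c f) k = cscale c (Poly_Mapping.lookup f k)"
  by transfer simp

lemma cscale_single: "cscale c (Poly_Mapping.single k a) = Poly_Mapping.single k (cscale c a)"
  by (rule poly_mapping_eqI) (simp add: lookup_cscale lookup_single when_def)

lemma cscale_eq_single_mult:
  fixes p :: "'a::monoid_add \<Rightarrow>\<^sub>0 'b::complex_alg"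
  shows "cscale c p = Poly_Mapping.single 0 (cscale c 1) * p"
    and "cscale c p = p * Poly_Mapping.single 0 (cscale c 1)"
proof -
  have pm_induct: "P p" if "\<And>k a. P (Poly_Mapping.single k a)" "\<And>p q. P p \<Longrightarrow> P q \<Longrightarrow> P (p + q)"
    for P and p :: "'a \<Rightarrow>\<^sub>0 'b"
  proof (induction p rule: update_induct)
    case const
    then show ?case using that(1)[of 0 0] by simp
  next
    case (update f a b)
    have "Poly_Mapping.update a b f = f + Poly_Mapping.single a b"
      using update by (intro poly_mapping_eqI) (auto simp: lookup_update lookup_add lookup_single
        when_def in_keys_iff)
    then show ?case using update that by metis
  qed
  show "cscale c p = Poly_Mapping.single 0 (cscale c 1) * p"
    by (induction p rule: pm_induct)
      (simp_all add: cscale_single mult_single cscale_mult_left cscale_add_right distrib_left)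
  show "cscale c p = p * Poly_Mapping.single 0 (cscale c 1)"
    by (induction p rule: pm_induct)
      (simp_all add: cscale_single mult_single cscale_mult_right cscale_add_right distrib_right)
qed

instance poly_mapping :: (monoid_add, complex_alg) complex_alg
proof
  fix c and x y :: "'a \<Rightarrow>\<^sub>0 'b"
  show "cscale c x * y = cscale c (x * y)"
    by (subst (1 2) cscale_eq_single_mult(1)) (simp add: mult.assoc)
  show "x * cscale c y = cscale c (x * y)"
    by (subst (1 2) cscale_eq_single_mult(2)) (simp add: mult.assoc)
qed

type_synonym 'a free_alg = "'a word \<Rightarrow>\<^sub>0 complex"

definition free_gen :: "'a \<Rightarrow> 'a free_alg"
  where "free_gen x = Poly_Mapping.single (Word [x]) 1"

definition free_eval :: "('a \<Rightarrow> 'b::complex_alg) \<Rightarrow> 'a free_alg \<Rightarrow> 'b"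
  where "free_eval f p = (\<Sum>w\<in>Poly_Mapping.keys p.
    cscale (Poly_Mapping.lookup p w) (prod_list (map f (letters w))))"

lemma free_eval_superset:
  assumes "finite A" "Poly_Mapping.keys p \<subseteq> A"
  shows "free_eval f p = (\<Sum>w\<in>A. cscale (Poly_Mapping.lookup p w) (prod_list (map f (letters w))))"
  unfolding free_eval_def using assms
  by (intro sum.mono_neutral_left) (auto simp: in_keys_iff)

lemma free_eval_add: "free_eval f (p + q) = free_eval f p + free_eval f q"
proof -
  let ?A = "Poly_Mapping.keys p \<union> Poly_Mapping.keys q"
  have "Poly_Mapping.keys (p + q) \<subseteq> ?A" by (rule Poly_Mapping.keys_add)
  then show ?thesis
    by (subst (1 2 3) free_eval_superset[of ?A])
      (auto simp: lookup_add cscale_add_left sum.distrib)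
qed

lemma free_eval_single:
  "free_eval f (Poly_Mapping.single w c) = cscale c (prod_list (map f (letters w)))"
  by (subst free_eval_superset[of "{w}"]) auto

lemma free_alg_induct [case_names single add]:
  fixes p :: "'a \<Rightarrow>\<^sub>0 'b::ab_group_add"
  assumes "\<And>k a. P (Poly_Mapping.single k a)" "\<And>p q. P p \<Longrightarrow> P q \<Longrightarrow> P (p + q)"
  shows "P p"
proof (induction p rule: update_induct)
  case const
  then show ?case using assms(1)[of undefined 0] by simp
next
  case (update f a b)
  have "Poly_Mapping.update a b f = f + Poly_Mapping.single a b"
    using update by (intro poly_mapping_eqI) (auto simp: lookup_update lookup_add lookup_single
      when_def in_keys_iff)
  then show ?case using update assms by metis
qed

lemma free_eval_mult: "free_eval f (p * q) = free_eval f p * free_eval f q"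
proof (induction p rule: free_alg_induct)
  case (single u a)
  show ?case
  proof (induction q rule: free_alg_induct)
    case (single v b)
    show ?case
      by (simp add: mult_single free_eval_single plus_word_def cscale_mult_left cscale_mult_right
          cscale_cscale mult.commute)
  qed (simp add: distrib_left free_eval_add)
qed (simp add: distrib_right free_eval_add)

lemma free_eval_cscale: "free_eval f (cscale c p) = cscale c (free_eval f p)"
proof (induction p rule: free_alg_induct)
  case (single w a)
  then show ?case by (simp add: cscale_single free_eval_single cscale_cscale cscale_complex_def)
qed (simp add: cscale_add_right free_eval_add)

lemma free_eval_one: "free_eval f 1 = 1"
  by (metis free_eval_single cscale_one letters_def list.map(1) prod_list.Nil single_one
      word.sel zero_word_def)

lemma free_eval_gen: "free_eval f (free_gen x) = f x"
  by (simp add: free_gen_def free_eval_single cscale_one)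

lemma free_eval_diff: "free_eval f (p - q) = free_eval f p - free_eval f q"
  using free_eval_add[of f "p - q" q] by (simp add: algebra_simps)


section \<open>The universal enveloping algebra\<close>

text \<open>The linearity relators cut the free algebra on the set \<^typ>\<open>'a\<close> down to the tensor
  algebra of the vector space \<^typ>\<open>'a\<close>; the last relators are the usual ones.\<close>

definition uea_relators :: "('a::complex_lie) free_alg set"
  where "uea_relators =
      {free_gen (x + y) - free_gen x - free_gen y | x y. True}
    \<union> {free_gen (cscale c x) - cscale c (free_gen x) | c x. True}
    \<union> {free_gen x * free_gen y - free_gen y * free_gen x - free_gen (lie_bracket x y) | x y. True}"

definition uea_ideal :: "('a::complex_lie) free_alg set"
  where "uea_ideal = two_sided_ideal hull uea_relators"

definition uea_rel :: "('a::complex_lie) free_alg \<Rightarrow> 'a free_alg \<Rightarrow> bool"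
  where "uea_rel p q \<longleftrightarrow> p - q \<in> uea_ideal"

lemma two_sided_ideal_uea: "two_sided_ideal uea_ideal"
  unfolding uea_ideal_def by (rule two_sided_ideal_hull)

lemma uea_ideal_zero: "0 \<in> uea_ideal"
  and uea_ideal_add: "p \<in> uea_ideal \<Longrightarrow> q \<in> uea_ideal \<Longrightarrow> p + q \<in> uea_ideal"
  and uea_ideal_lmult: "p \<in> uea_ideal \<Longrightarrow> a * p \<in> uea_ideal"
  and uea_ideal_rmult: "p \<in> uea_ideal \<Longrightarrow> p * a \<in> uea_ideal"
  using two_sided_ideal_uea unfolding two_sided_ideal_def by auto

lemma uea_ideal_uminus: "p \<in> uea_ideal \<Longrightarrow> - p \<in> uea_ideal"
  using uea_ideal_lmult[of p "- 1"] by simp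

lemma uea_ideal_cscale: "p \<in> uea_ideal \<Longrightarrow> cscale c p \<in> uea_ideal"
  by (subst cscale_eq_single_mult(1)) (rule uea_ideal_lmult)

quotient_type (overloaded) 'a uea = "('a::complex_lie) free_alg" / uea_rel
proof (rule equivpI)
  show "reflp uea_rel" by (simp add: reflp_def uea_rel_def uea_ideal_zero)
  show "symp uea_rel"
  proof (rule sympI)
    fix p q assume "uea_rel p q"
    then show "uea_rel q p" using uea_ideal_uminus[of "p - q"] by (simp add: uea_rel_def)
  qed
  show "transp uea_rel"
  proof (rule transpI)
    fix p q r assume "uea_rel p q" "uea_rel q r"
    then show "uea_rel p r" using uea_ideal_add[of "p - q" "q - r"] by (simp add: uea_rel_def)
  qed
qed

text \<open>The algebra homomorphism out of the free algebra kills the ideal when the map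
  on generators is linear and sends brackets to commutators.\<close>

definition lie_to_alg_hom :: "('a::complex_lie \<Rightarrow> 'b::complex_alg) \<Rightarrow> bool"
  where "lie_to_alg_hom f \<longleftrightarrow> clinear f \<and> (\<forall>x y. f (lie_bracket x y) = f x * f y - f y * f x)"

lemma free_eval_uea_ideal:
  assumes "lie_to_alg_hom f" "p \<in> uea_ideal"
  shows "free_eval f p = 0"
proof -
  have "p \<in> two_sided_ideal hull uea_relators"
    using assms(2) by (simp add: uea_ideal_def)
  then show ?thesis
  proof (rule hull_induct)
    have f: "f (x + y) = f x + f y" "f (cscale c x) = cscale c (f x)"
      "f (lie_bracket x y) = f x * f y - f y * f x" for x y c
      using assms(1) by (simp_all add: lie_to_alg_hom_def clinear_add[of f] clinear_cscale[of f])
    show "free_eval f x = 0" if "x \<in> uea_relators" for x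
      using that unfolding uea_relators_def
      by (auto simp: free_eval_diff free_eval_mult free_eval_gen free_eval_cscale f)
    show "two_sided_ideal {x. free_eval f x = 0}"
      using free_eval_add[of f 0 0]
      by (auto simp: two_sided_ideal_def free_eval_add free_eval_mult)
  qed
qed

instantiation uea :: (complex_lie) complex_alg
begin

lift_definition zero_uea :: "'a uea" is 0 .
lift_definition one_uea :: "'a uea" is 1 .
lift_definition plus_uea :: "'a uea \<Rightarrow> 'a uea \<Rightarrow> 'a uea" is "(+)"
  unfolding uea_rel_def by (metis add_diff_add uea_ideal_add)
lift_definition uminus_uea :: "'a uea \<Rightarrow> 'a uea" is uminus
  unfolding uea_rel_def by (metis minus_diff_minus uea_ideal_uminus)
lift_definition minus_uea :: "'a uea \<Rightarrow> 'a uea \<Rightarrow> 'a uea" is "(-)"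
proof -
  fix p p' q q' :: "'a free_alg" assume "uea_rel p p'" "uea_rel q q'"
  then have "(p - p') + - (q - q') \<in> uea_ideal"
    unfolding uea_rel_def by (intro uea_ideal_add uea_ideal_uminus)
  then show "uea_rel (p - q) (p' - q')" unfolding uea_rel_def by (simp add: algebra_simps)
qed
lift_definition times_uea :: "'a uea \<Rightarrow> 'a uea \<Rightarrow> 'a uea" is "(*)"
proof -
  fix p p' q q' :: "'a free_alg" assume "uea_rel p p'" "uea_rel q q'"
  then have "(p - p') * q + p' * (q - q') \<in> uea_ideal"
    unfolding uea_rel_def by (intro uea_ideal_add uea_ideal_lmult uea_ideal_rmult)
  then show "uea_rel (p * q) (p' * q')" unfolding uea_rel_def by (simp add: algebra_simps)
qed
lift_definition cscale_uea :: "complex \<Rightarrow> 'a uea \<Rightarrow> 'a uea" is cscale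
  unfolding uea_rel_def by (metis cvec.scale_right_diff_distrib uea_ideal_cscale)

lemma uea_relI: "p = q \<Longrightarrow> uea_rel p q"
  by (simp add: uea_rel_def uea_ideal_zero)

instance
proof
  show "(0::'a uea) \<noteq> 1"
  proof (transfer, rule notI)
    assume "uea_rel 0 (1 :: 'a free_alg)"
    then have "0 - 1 \<in> (uea_ideal :: 'a free_alg set)" by (simp add: uea_rel_def)
    moreover have "lie_to_alg_hom (\<lambda>_::'a. 0 :: complex)"
      by (auto simp: lie_to_alg_hom_def intro: clinearI)
    ultimately have "free_eval (\<lambda>_::'a. 0 :: complex) (0 - 1) = 0"
      using free_eval_uea_ideal by blast
    then show False unfolding free_eval_diff free_eval_one by (simp add: free_eval_def)
  qed
qed (transfer, rule uea_relI, simp add: algebra_simps cscale_add_right cscale_add_left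
    cscale_cscale cscale_one cscale_mult_left cscale_mult_right)+

end

lift_definition uea_of :: "'a::complex_lie \<Rightarrow> 'a uea" is free_gen .

text \<open>Universal property: \<open>uea_lift f\<close> is the algebra homomorphism extending \<open>f\<close>. It is
  evaluated on a chosen representative, which is immaterial for \<^term>\<open>lie_to_alg_hom f\<close>.\<close>

definition uea_lift :: "('a::complex_lie \<Rightarrow> 'b::complex_alg) \<Rightarrow> 'a uea \<Rightarrow> 'b"
  where "uea_lift f u = free_eval f (rep_uea u)"

lemma uea_lift_abs:
  assumes "lie_to_alg_hom f"
  shows "uea_lift f (abs_uea p) = free_eval f p"
proof -
  have "uea_rel (rep_uea (abs_uea p)) p"
    by (simp only: uea.abs_eq_iff[symmetric] Quotient3_abs_rep[OF Quotient3_uea])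
  then show ?thesis
    using free_eval_uea_ideal[OF assms] unfolding uea_lift_def uea_rel_def
    by (metis free_eval_diff eq_iff_diff_eq_0)
qed

lemma uea_lift_hom:
  assumes "lie_to_alg_hom f"
  shows "uea_lift f (uea_of x) = f x" "uea_lift f 1 = 1"
    "uea_lift f (u + v) = uea_lift f u + uea_lift f v"
    "uea_lift f (u * v) = uea_lift f u * uea_lift f v"
    "uea_lift f (cscale c u) = cscale c (uea_lift f u)"
proof -
  define p q where "p = rep_uea u" and "q = rep_uea v"
  then have uv: "u = abs_uea p" "v = abs_uea q"
    by (simp_all only: Quotient3_abs_rep[OF Quotient3_uea])
  show "uea_lift f (uea_of x) = f x"
    by (simp add: uea_of.abs_eq uea_lift_abs[OF assms] free_eval_gen)
  show "uea_lift f 1 = 1"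
    by (simp add: one_uea.abs_eq uea_lift_abs[OF assms] free_eval_one)
  show "uea_lift f (u + v) = uea_lift f u + uea_lift f v"
    by (simp add: uv plus_uea.abs_eq uea_lift_abs[OF assms] free_eval_add)
  show "uea_lift f (u * v) = uea_lift f u * uea_lift f v"
    by (simp add: uv times_uea.abs_eq uea_lift_abs[OF assms] free_eval_mult)
  show "uea_lift f (cscale c u) = cscale c (uea_lift f u)"
    by (simp add: uv cscale_uea.abs_eq uea_lift_abs[OF assms] free_eval_cscale)
qed

lemma lie_to_alg_hom_uea_of: "lie_to_alg_hom uea_of"
proof -
  have eq: "abs_uea p = abs_uea q" if "p - q \<in> uea_relators" for p q :: "'a free_alg"
    using that by (simp add: uea.abs_eq_iff uea_rel_def uea_ideal_def hull_inc)
  have "uea_of (x + y) = uea_of x + uea_of y" for x y :: 'a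
    unfolding uea_of.abs_eq plus_uea.abs_eq
    by (rule eq) (auto simp only: uea_relators_def diff_diff_eq[symmetric])
  moreover have "uea_of (cscale c x) = cscale c (uea_of x)" for c and x :: 'a
    unfolding uea_of.abs_eq cscale_uea.abs_eq
    by (rule eq) (auto simp only: uea_relators_def)
  moreover have "uea_of (lie_bracket x y) = uea_of x * uea_of y - uea_of y * uea_of x" for x y :: 'a
    unfolding uea_of.abs_eq times_uea.abs_eq minus_uea.abs_eq
    by (rule eq[symmetric]) (auto simp only: uea_relators_def)
  ultimately show ?thesis
    unfolding lie_to_alg_hom_def by (intro conjI allI clinearI)
qed

lemma lie_to_alg_hom_complex: "lie_hom \<psi> \<Longrightarrow> lie_to_alg_hom (\<psi> :: 'a::complex_lie \<Rightarrow> complex)"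
  by (simp add: lie_hom_def lie_to_alg_hom_def lie_bracket_complex_def)


section \<open>Tensor products over a noncommutative ring\<close>

text \<open>\<open>r\<close> is the right action of \<^typ>\<open>'s\<close> on \<^typ>\<open>'m\<close> and \<open>l\<close> its left action on
  \<^typ>\<open>'n\<close>; the tensor product is a quotient of the free abelian group on
  \<^typ>\<open>'m \<times> 'n\<close>, with elements the equivalence classes.\<close>

definition tensor_relators ::
    "('m::ab_group_add \<Rightarrow> 's \<Rightarrow> 'm) \<Rightarrow> ('s \<Rightarrow> 'n::ab_group_add \<Rightarrow> 'n) \<Rightarrow> ('m \<times> 'n \<Rightarrow>\<^sub>0 int) set"
  where "tensor_relators r l =
      {frag_of (m + m', n) - frag_of (m, n) - frag_of (m', n) | m m' n. True}
    \<union> {frag_of (m, n + n') - frag_of (m, n) - frag_of (m, n') | m n n'. True}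
    \<union> {frag_of (r m s, n) - frag_of (m, l s n) | m s n. True}"

definition tensor_rel ::
    "('m::ab_group_add \<Rightarrow> 's \<Rightarrow> 'm) \<Rightarrow> ('s \<Rightarrow> 'n::ab_group_add \<Rightarrow> 'n) \<Rightarrow> ('m \<times> 'n \<Rightarrow>\<^sub>0 int) rel"
  where "tensor_rel r l = {(x, y). x - y \<in> additive_subgroup hull (tensor_relators r l)}"

definition tensor_prod ::
    "('m::ab_group_add \<Rightarrow> 's \<Rightarrow> 'm) \<Rightarrow> ('s \<Rightarrow> 'n::ab_group_add \<Rightarrow> 'n) \<Rightarrow> ('m \<times> 'n \<Rightarrow>\<^sub>0 int) set set"
  where "tensor_prod r l = UNIV // tensor_rel r l"

definition pure_tensor ::
    "('m::ab_group_add \<Rightarrow> 's \<Rightarrow> 'm) \<Rightarrow> ('s \<Rightarrow> 'n::ab_group_add \<Rightarrow> 'n) \<Rightarrow> 'm \<Rightarrow> 'n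
      \<Rightarrow> ('m \<times> 'n \<Rightarrow>\<^sub>0 int) set"
  where "pure_tensor r l m n = tensor_rel r l `` {frag_of (m, n)}"

text \<open>The map \<open>h \<otimes> id\<close> for an additive \<open>h\<close> commuting with the right action.\<close>

definition tensor_map_left ::
    "('m::ab_group_add \<Rightarrow> 's \<Rightarrow> 'm) \<Rightarrow> ('s \<Rightarrow> 'n::ab_group_add \<Rightarrow> 'n) \<Rightarrow> ('m \<Rightarrow> 'm)
      \<Rightarrow> ('m \<times> 'n \<Rightarrow>\<^sub>0 int) set \<Rightarrow> ('m \<times> 'n \<Rightarrow>\<^sub>0 int) set"
  where "tensor_map_left r l h X =
    (\<Union>x\<in>X. tensor_rel r l `` {frag_extend (\<lambda>(m, n). frag_of (h m, n)) x})"

lemma equiv_tensor_rel: "equiv UNIV (tensor_rel r l)"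
proof (rule equivI)
  let ?N = "additive_subgroup hull tensor_relators r l"
  have sg: "0 \<in> ?N" "\<And>x y. x \<in> ?N \<Longrightarrow> y \<in> ?N \<Longrightarrow> x - y \<in> ?N"
    using additive_subgroup_hull[of "tensor_relators r l"] by (auto simp: additive_subgroup_def)
  show "refl (tensor_rel r l)" using sg by (auto simp: refl_on_def tensor_rel_def)
  show "sym (tensor_rel r l)"
  proof (rule symI)
    fix x y assume "(x, y) \<in> tensor_rel r l"
    then show "(y, x) \<in> tensor_rel r l"
      using sg(2)[OF sg(1), of "x - y"] by (simp add: tensor_rel_def)
  qed
  show "trans (tensor_rel r l)"
  proof (rule transI)
    fix x y z assume a: "(x, y) \<in> tensor_rel r l" "(y, z) \<in> tensor_rel r l"
    then have "(x - y) - (0 - (y - z)) \<in> ?N"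
      by (intro sg(2)[OF _ sg(2)[OF sg(1)]]) (simp_all add: tensor_rel_def)
    then show "(x, z) \<in> tensor_rel r l" by (simp add: tensor_rel_def)
  qed
qed auto

lemma tensor_map_left_class:
  assumes add: "\<And>m m'. h (m + m') = h m + h m'" and comm: "\<And>m s. h (r m s) = r (h m) s"
  shows "tensor_map_left r l h (tensor_rel r l `` {x})
    = tensor_rel r l `` {frag_extend (\<lambda>(m, n). frag_of (h m, n)) x}"
proof -
  let ?e = "frag_extend (\<lambda>(m, n). frag_of (h m, n))"
  let ?N = "additive_subgroup hull tensor_relators r l"
  have e: "?e y \<in> ?N" if "y \<in> ?N" for y
    using that
  proof (rule hull_induct)
    show "?e y \<in> ?N" if "y \<in> tensor_relators r l" for y
    proof -
      from that consider
          m m' n where "y = frag_of (m + m', n) - frag_of (m, n) - frag_of (m', n)"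
        | m n n' where "y = frag_of (m, n + n') - frag_of (m, n) - frag_of (m, n')"
        | m s n where "y = frag_of (r m s, n) - frag_of (m, l s n)"
        unfolding tensor_relators_def by blast
      then have "?e y \<in> tensor_relators r l"
      proof cases
        case 1
        then have "?e y = frag_of (h m + h m', n) - frag_of (h m, n) - frag_of (h m', n)"
          by (simp add: frag_extend_diff add)
        then show ?thesis unfolding tensor_relators_def by blast
      next
        case 2
        then have "?e y = frag_of (h m, n + n') - frag_of (h m, n) - frag_of (h m, n')"
          by (simp add: frag_extend_diff)
        then show ?thesis unfolding tensor_relators_def by blast
      next
        case 3
        then have "?e y = frag_of (r (h m) s, n) - frag_of (h m, l s n)"
          by (simp add: frag_extend_diff comm)
        then show ?thesis unfolding tensor_relators_def by blast
      qed
      then show ?thesis by (rule hull_inc)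
    qed
    show "additive_subgroup {y. ?e y \<in> ?N}"
      using additive_subgroup_hull[of "tensor_relators r l"]
      by (auto simp: additive_subgroup_def frag_extend_diff)
  qed
  have "tensor_rel r l `` {?e y} = tensor_rel r l `` {?e x}" if "(x, y) \<in> tensor_rel r l" for y
  proof -
    have "(?e x, ?e y) \<in> tensor_rel r l"
      using e[of "x - y"] that by (simp add: tensor_rel_def frag_extend_diff)
    then show ?thesis using equiv_class_eq[OF equiv_tensor_rel] by blast
  qed
  moreover have "x \<in> tensor_rel r l `` {x}"
    by (rule equiv_class_self[OF equiv_tensor_rel]) simp
  ultimately show ?thesis unfolding tensor_map_left_def by blast
qed


section \<open>The Schroedinger-Virasoro algebra\<close>

text \<open>\<open>Y n\<close> stands for the basis element with index \<open>n + 1/2\<close>.\<close>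

datatype sv_index = L int | M int | Y int

typedef sv = "UNIV :: (sv_index \<Rightarrow>\<^sub>0 complex) set" morphisms sv_coeffs Abs_sv ..

setup_lifting type_definition_sv

instantiation sv :: complex_vec
begin
lift_definition zero_sv :: sv is 0 .
lift_definition plus_sv :: "sv \<Rightarrow> sv \<Rightarrow> sv" is "(+)" .
lift_definition minus_sv :: "sv \<Rightarrow> sv \<Rightarrow> sv" is "(-)" .
lift_definition uminus_sv :: "sv \<Rightarrow> sv" is uminus .
lift_definition cscale_sv :: "complex \<Rightarrow> sv \<Rightarrow> sv" is cscale .
instance
  by standard (transfer; simp add: cscale_add_right cscale_add_left cscale_cscale cscale_one)+
end

lift_definition sv_basis :: "sv_index \<Rightarrow> sv" is "\<lambda>i. Poly_Mapping.single i 1" .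

fun basis_bracket :: "sv_index \<Rightarrow> sv_index \<Rightarrow> sv" where
  "basis_bracket (L m) (L n) = cscale (of_int (n - m)) (sv_basis (L (m + n)))"
| "basis_bracket (L m) (M n) = cscale (of_int n) (sv_basis (M (m + n)))"
| "basis_bracket (M n) (L m) = - cscale (of_int n) (sv_basis (M (m + n)))"
| "basis_bracket (L m) (Y n) = cscale (of_int n + (1 - of_int m) / 2) (sv_basis (Y (m + n)))"
| "basis_bracket (Y n) (L m) = - cscale (of_int n + (1 - of_int m) / 2) (sv_basis (Y (m + n)))"
| "basis_bracket (Y m) (Y n) = cscale (of_int (n - m)) (sv_basis (M (m + n + 1)))"
| "basis_bracket (M m) (M n) = 0"
| "basis_bracket (M m) (Y n) = 0"
| "basis_bracket (Y n) (M m) = 0"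

definition sv_bracket :: "sv \<Rightarrow> sv \<Rightarrow> sv"
  where "sv_bracket x y =
    (\<Sum>i\<in>Poly_Mapping.keys (sv_coeffs x). \<Sum>j\<in>Poly_Mapping.keys (sv_coeffs y).
      cscale (Poly_Mapping.lookup (sv_coeffs x) i * Poly_Mapping.lookup (sv_coeffs y) j)
        (basis_bracket i j))"

lemma sv_bracket_superset:
  assumes "finite A" "Poly_Mapping.keys (sv_coeffs x) \<subseteq> A"
    and "finite B" "Poly_Mapping.keys (sv_coeffs y) \<subseteq> B"
  shows "sv_bracket x y = (\<Sum>i\<in>A. \<Sum>j\<in>B.
      cscale (Poly_Mapping.lookup (sv_coeffs x) i * Poly_Mapping.lookup (sv_coeffs y) j)
        (basis_bracket i j))"
proof -
  have "sv_bracket x y = (\<Sum>i\<in>Poly_Mapping.keys (sv_coeffs x). \<Sum>j\<in>B.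
      cscale (Poly_Mapping.lookup (sv_coeffs x) i * Poly_Mapping.lookup (sv_coeffs y) j)
        (basis_bracket i j))"
    unfolding sv_bracket_def using assms
    by (intro sum.cong refl sum.mono_neutral_left) (auto simp: in_keys_iff)
  also have "\<dots> = (\<Sum>i\<in>A. \<Sum>j\<in>B.
      cscale (Poly_Mapping.lookup (sv_coeffs x) i * Poly_Mapping.lookup (sv_coeffs y) j)
        (basis_bracket i j))"
    using assms by (intro sum.mono_neutral_left) (auto simp: in_keys_iff)
  finally show ?thesis .
qed

lemma sv_bracket_add_left: "sv_bracket (x + y) z = sv_bracket x z + sv_bracket y z"
proof -
  let ?A = "Poly_Mapping.keys (sv_coeffs x) \<union> Poly_Mapping.keys (sv_coeffs y)"
  have "Poly_Mapping.keys (sv_coeffs (x + y)) \<subseteq> ?A"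
    by (simp add: plus_sv.rep_eq Poly_Mapping.keys_add)
  then show ?thesis
    by (subst (1 2 3) sv_bracket_superset[of ?A _ "Poly_Mapping.keys (sv_coeffs z)"])
      (auto simp: plus_sv.rep_eq lookup_add distrib_right cscale_add_left sum.distrib)
qed

lemma sv_bracket_add_right: "sv_bracket z (x + y) = sv_bracket z x + sv_bracket z y"
proof -
  let ?A = "Poly_Mapping.keys (sv_coeffs x) \<union> Poly_Mapping.keys (sv_coeffs y)"
  have "Poly_Mapping.keys (sv_coeffs (x + y)) \<subseteq> ?A"
    by (simp add: plus_sv.rep_eq Poly_Mapping.keys_add)
  then show ?thesis
    by (subst (1 2 3) sv_bracket_superset[of "Poly_Mapping.keys (sv_coeffs z)" _ ?A])
      (auto simp: plus_sv.rep_eq lookup_add distrib_left cscale_add_left sum.distrib)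
qed

lemma keys_sv_cscale: "Poly_Mapping.keys (sv_coeffs (cscale c x)) \<subseteq> Poly_Mapping.keys (sv_coeffs x)"
  by (auto simp: in_keys_iff cscale_sv.rep_eq lookup_cscale cscale_complex_def)

lemma sv_bracket_scale_left: "sv_bracket (cscale c x) y = cscale c (sv_bracket x y)"
  by (subst (1 2) sv_bracket_superset[of "Poly_Mapping.keys (sv_coeffs x)" _
        "Poly_Mapping.keys (sv_coeffs y)"])
    (use keys_sv_cscale in \<open>auto simp: cscale_sv.rep_eq lookup_cscale cscale_complex_def
      cvec.scale_sum_right cscale_cscale mult.assoc\<close>)

lemma sv_bracket_scale_right: "sv_bracket x (cscale c y) = cscale c (sv_bracket x y)"
  by (subst (1 2) sv_bracket_superset[of "Poly_Mapping.keys (sv_coeffs x)" _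
        "Poly_Mapping.keys (sv_coeffs y)"])
    (use keys_sv_cscale in \<open>auto simp: cscale_sv.rep_eq lookup_cscale cscale_complex_def
      cvec.scale_sum_right cscale_cscale mult_ac\<close>)

lemma sv_bracket_basis [simp]: "sv_bracket (sv_basis i) (sv_basis j) = basis_bracket i j"
  by (simp add: sv_bracket_def sv_basis.rep_eq cscale_one)

lemma sv_induct [case_names scale add]:
  assumes "\<And>c i. P (cscale c (sv_basis i))" "\<And>x y. P x \<Longrightarrow> P y \<Longrightarrow> P (x + y)"
  shows "P x"
proof -
  have "P (Abs_sv p)" for p
  proof (induction p rule: free_alg_induct)
    case (single k a)
    have "Abs_sv (Poly_Mapping.single k a) = cscale a (sv_basis k)"
      by (simp add: cscale_sv.abs_eq sv_basis.abs_eq eq_onp_same_args cscale_single cscale_complex_def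
          sv_basis_def)
    then show ?case using assms(1) by simp
  next
    case (add p q)
    then show ?case using assms(2) by (metis plus_sv.abs_eq eq_onp_same_args UNIV_I)
  qed
  then show ?thesis by (metis sv_coeffs_inverse)
qed

lemma basis_bracket_skew: "basis_bracket j i = - basis_bracket i j"
proof -
  have *: "cscale (of_int n - of_int m) x = - cscale (of_int m - of_int n) x" for m n and x :: sv
    by (metis cvec.scale_minus_left minus_diff_eq)
  show ?thesis by (cases i; cases j) (auto simp: add.commute intro: *)
qed

lemma sv_bracket_skew: "sv_bracket y x = - sv_bracket x y"
proof (induction x rule: sv_induct)
  case (scale c i)
  show ?case
  proof (induction y rule: sv_induct)
    case (scale d j)
    show ?case using basis_bracket_skew[of j i]
      by (simp add: sv_bracket_scale_left sv_bracket_scale_right cscale_cscale mult.commute)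
  qed (simp add: sv_bracket_add_left sv_bracket_add_right)
qed (simp add: sv_bracket_add_left sv_bracket_add_right)

lemma sv_bracket_minus: "sv_bracket x (- y) = - sv_bracket x y"
  using sv_bracket_scale_right[of x "-1" y] by (simp add: cscale_one)

lemma sv_bracket_zero: "sv_bracket x 0 = 0"
  using sv_bracket_scale_right[of x 0 0] by simp

lemma sv_jacobi_basis:
  "sv_bracket (sv_basis i) (sv_bracket (sv_basis j) (sv_basis k))
   + sv_bracket (sv_basis j) (sv_bracket (sv_basis k) (sv_basis i))
   + sv_bracket (sv_basis k) (sv_bracket (sv_basis i) (sv_basis j)) = 0"
proof -
  have z: "cscale a x + cscale b x + cscale c x = 0" if "a + b + c = 0" for a b c and x :: sv
    using that by (metis cscale_add_left cvec.scale_zero_left)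
  show ?thesis
    by (cases i; cases j; cases k)
      (simp_all add: sv_bracket_minus sv_bracket_zero sv_bracket_scale_right cscale_cscale add_ac
        flip: cvec.scale_minus_left cscale_add_left,
       (simp_all add: field_simps)?)
qed

lemma sv_jacobi:
  "sv_bracket x (sv_bracket y z) + sv_bracket y (sv_bracket z x) + sv_bracket z (sv_bracket x y) = 0"
  (is "?J x y z = 0")
proof -
  note simps = sv_bracket_scale_left sv_bracket_scale_right sv_bracket_add_left sv_bracket_add_right
  have scale: "?J (cscale a (sv_basis i)) (cscale b (sv_basis j)) (cscale c (sv_basis k)) = 0"
    for a b c i j k
  proof -
    have "?J (cscale a (sv_basis i)) (cscale b (sv_basis j)) (cscale c (sv_basis k))
        = cscale (a * b * c) (?J (sv_basis i) (sv_basis j) (sv_basis k))"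
      by (simp add: simps cscale_cscale cscale_add_right mult_ac del: sv_bracket_basis)
    also have "\<dots> = 0" by (simp only: sv_jacobi_basis cvec.scale_zero_right)
    finally show ?thesis .
  qed
  have add: "u + u' + (v + v') + (w + w') = 0" if "u + v + w = 0" "u' + v' + w' = 0"
    for u u' v v' w w' :: sv
  proof -
    have "u + u' + (v + v') + (w + w') = (u + v + w) + (u' + v' + w')" by (simp add: add_ac)
    then show ?thesis using that by simp
  qed
  have 1: "?J (cscale a (sv_basis i)) (cscale b (sv_basis j)) z = 0" for a b i j z
    by (induction z rule: sv_induct) (rule scale, unfold simps(3,4), rule add)
  have 2: "?J (cscale a (sv_basis i)) y z = 0" for a i y z
    by (induction y rule: sv_induct) (rule 1, unfold simps(3,4), rule add)
  show ?thesis
    by (induction x rule: sv_induct) (rule 2, unfold simps(3,4), rule add)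
qed

instantiation sv :: complex_lie
begin
definition lie_bracket_sv :: "sv \<Rightarrow> sv \<Rightarrow> sv" where "lie_bracket_sv = sv_bracket"
instance
proof
  fix x y z :: sv and c :: complex
  have "sv_bracket x x + sv_bracket x x = 0"
    using sv_bracket_skew[of x x] by (metis add.left_inverse)
  then have "cscale 2 (sv_bracket x x) = 0"
    by (metis cscale_add_left cscale_one one_add_one)
  then show "lie_bracket x x = 0" by (simp add: lie_bracket_sv_def)
qed (simp_all add: lie_bracket_sv_def sv_bracket_add_left sv_bracket_add_right
      sv_bracket_scale_left sv_bracket_scale_right sv_jacobi)
end

abbreviation sv_plus_basis :: "sv set"
  where "sv_plus_basis \<equiv> {sv_basis (L n) | n. n \<ge> 1} \<union> {sv_basis (M n) | n. n \<ge> 1}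
    \<union> {sv_basis (Y m) | m. m \<ge> 0}"

typedef sv_plus = "cvec.span sv_plus_basis" morphisms sv_incl Abs_sv_plus
  by (rule exI, rule cvec.span_zero)

lemma sv_plus_bracket_closed:
  assumes x: "x \<in> cvec.span sv_plus_basis" and y: "y \<in> cvec.span sv_plus_basis"
  shows "lie_bracket x y \<in> cvec.span sv_plus_basis"
  using x
proof (induction rule: cvec.span_induct_alt)
  case base
  show ?case using lie_scale_left[of 0 0 y] by (simp add: cvec.span_zero)
next
  case (step c a x)
  have "lie_bracket a y \<in> cvec.span sv_plus_basis"
    using y
  proof (induction rule: cvec.span_induct_alt)
    case base
    show ?case using lie_scale_right[of a 0 0] by (simp add: cvec.span_zero)
  next
    case (step d b y)
    have span: "sv_basis (L n) \<in> cvec.span sv_plus_basis"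
      "sv_basis (M n) \<in> cvec.span sv_plus_basis" if "n \<ge> 1" for n
      using that by (auto intro!: cvec.span_base)
    have span_Y: "sv_basis (Y n) \<in> cvec.span sv_plus_basis" if "n \<ge> 0" for n
      using that by (auto intro!: cvec.span_base)
    have "lie_bracket a b \<in> cvec.span sv_plus_basis"
      using \<open>a \<in> sv_plus_basis\<close> \<open>b \<in> sv_plus_basis\<close>
      by (auto simp: lie_bracket_sv_def cvec.span_zero
          intro!: cvec.span_scale cvec.span_neg span span_Y)
    with step show ?case
      by (simp add: lie_add_right lie_scale_right cvec.span_add cvec.span_scale)
  qed
  with step show ?case
    by (simp add: lie_add_left lie_scale_left cvec.span_add cvec.span_scale)
qed

setup_lifting type_definition_sv_plus

instantiation sv_plus :: complex_lie
begin
lift_definition zero_sv_plus :: sv_plus is 0 by (rule cvec.span_zero)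
lift_definition plus_sv_plus :: "sv_plus \<Rightarrow> sv_plus \<Rightarrow> sv_plus" is "(+)" by (rule cvec.span_add)
lift_definition minus_sv_plus :: "sv_plus \<Rightarrow> sv_plus \<Rightarrow> sv_plus" is "(-)" by (rule cvec.span_diff)
lift_definition uminus_sv_plus :: "sv_plus \<Rightarrow> sv_plus" is uminus by (rule cvec.span_neg)
lift_definition cscale_sv_plus :: "complex \<Rightarrow> sv_plus \<Rightarrow> sv_plus" is cscale by (rule cvec.span_scale)
lift_definition lie_bracket_sv_plus :: "sv_plus \<Rightarrow> sv_plus \<Rightarrow> sv_plus" is lie_bracket
  by (rule sv_plus_bracket_closed)
instance
  by standard (transfer; simp add: cscale_add_right cscale_add_left cscale_cscale cscale_one
      lie_add_left lie_add_right lie_scale_left lie_scale_right lie_self lie_jacobi)+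
end

lemma lie_hom_sv_incl: "lie_hom sv_incl"
  by (auto simp: lie_hom_def plus_sv_plus.rep_eq cscale_sv_plus.rep_eq lie_bracket_sv_plus.rep_eq
      intro: clinearI)


section \<open>The module \<open>W\<^sub>\<psi>\<close> and its Whittaker vectors\<close>

text \<open>\<open>U(sv\<^sup>+)\<close> acts on \<open>U(sv)\<close> from the right through the induced homomorphism; that this is an
  embedding (PBW) plays no role in the construction.\<close>

definition uea_incl :: "sv_plus uea \<Rightarrow> sv uea"
  where "uea_incl = uea_lift (\<lambda>x. uea_of (sv_incl x))"

lemma lie_to_alg_hom_incl: "lie_to_alg_hom (\<lambda>x. uea_of (sv_incl x))"
proof -
  have h: "lie_to_alg_hom (uea_of :: sv \<Rightarrow> _)" by (rule lie_to_alg_hom_uea_of)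
  then show ?thesis
    by (auto simp: lie_to_alg_hom_def plus_sv_plus.rep_eq cscale_sv_plus.rep_eq
        lie_bracket_sv_plus.rep_eq clinear_add[of uea_of] clinear_cscale[of uea_of]
        intro!: clinearI)
qed

abbreviation uea_right_act :: "sv uea \<Rightarrow> sv_plus uea \<Rightarrow> sv uea"
  where "uea_right_act u s \<equiv> u * uea_incl s"

abbreviation C_psi_act :: "(sv_plus \<Rightarrow> complex) \<Rightarrow> sv_plus uea \<Rightarrow> complex \<Rightarrow> complex"
  where "C_psi_act \<psi> s \<alpha> \<equiv> uea_lift \<psi> s * \<alpha>"

type_synonym W_elem = "(sv uea \<times> complex \<Rightarrow>\<^sub>0 int) set"

definition W :: "(sv_plus \<Rightarrow> complex) \<Rightarrow> W_elem set"
  where "W \<psi> = tensor_prod uea_right_act (C_psi_act \<psi>)"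

definition W_act :: "(sv_plus \<Rightarrow> complex) \<Rightarrow> sv uea \<Rightarrow> W_elem \<Rightarrow> W_elem"
  where "W_act \<psi> u = tensor_map_left uea_right_act (C_psi_act \<psi>) (\<lambda>u'. u * u')"

text \<open>The complex vector space structure comes from the scalars in \<open>U(sv)\<close>.\<close>

definition W_scale :: "(sv_plus \<Rightarrow> complex) \<Rightarrow> complex \<Rightarrow> W_elem \<Rightarrow> W_elem"
  where "W_scale \<psi> c = W_act \<psi> (cscale c 1)"

definition W_gen :: "(sv_plus \<Rightarrow> complex) \<Rightarrow> W_elem"
  where "W_gen \<psi> = pure_tensor uea_right_act (C_psi_act \<psi>) 1 1"

lemma W_act_pure:
  "W_act \<psi> u (pure_tensor uea_right_act (C_psi_act \<psi>) u' \<alpha>)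
    = pure_tensor uea_right_act (C_psi_act \<psi>) (u * u') \<alpha>"
  unfolding W_act_def pure_tensor_def
  by (subst tensor_map_left_class) (simp_all add: algebra_simps)

definition whittaker_vectors :: "(sv_plus \<Rightarrow> complex) \<Rightarrow> W_elem set"
  where "whittaker_vectors \<psi> =
    {v \<in> W \<psi>. \<forall>x. W_act \<psi> (uea_of (sv_incl x)) v = W_scale \<psi> (\<psi> x) v}"

definition L0_M0_subalgebra :: "sv uea set"
  where "L0_M0_subalgebra =
    complex_subalgebra hull {uea_of (sv_basis (L 0)), uea_of (sv_basis (M 0))}"

end

theory Submission
  imports Defs
begin

text \<open>
  For \<open>\<psi> = 0\<close> the module \<open>W\<^sub>\<psi>\<close> is the quotient of \<open>U(sv)\<close> by the left ideal generated by \<open>sv\<^sup>+\<close>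
  (\<open>pure_eq_iff_left_ideal\<close>), and a Whittaker vector is a singular vector: one killed by all
  positive generators. By the Poincare-Birkhoff-Witt theorem, \<open>W\<^sub>\<psi>\<close> has as a basis the ordered monomials
  in \<open>M\<^sub>0\<close>, the \<open>M\<^sub>n\<close>, \<open>Y\<^bsub>n+1/2\<^esub>\<close>, \<open>L\<^sub>n\<close> with \<open>n < 0\<close>, and \<open>L\<^sub>0\<close>, applied to \<open>w\<close>. Polynomials in
  \<open>L\<^sub>0\<close> and \<open>M\<^sub>0\<close> give singular vectors because the bracket of \<open>L\<^sub>0\<close> or \<open>M\<^sub>0\<close> with a positive basis
  element is a multiple of that element.

  The converse rests on the fact that \<open>M\<^sub>0\<close> is central and acts without torsion, and that each remaining
  letter has a positive partner whose bracket with it is a nonzero multiple of \<open>M\<^sub>0\<close>: \<open>M\<^sub>n\<close> for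
  \<open>L\<^bsub>-n\<^esub>\<close>, \<open>Y\<^bsub>n+1/2\<^esub>\<close> for \<open>Y\<^bsub>-n-1/2\<^esub>\<close>, and \<open>L\<^sub>n\<close> for \<open>M\<^bsub>-n\<^esub>\<close>. If \<open>n\<close> is maximal among the letters
  of the relevant kind, the partner acts on monomials as \<open>M\<^sub>0\<close> times a derivative
  (\<open>lowering_formula\<close>): its brackets with the other letters are zero or multiples of some
  \<open>M\<^sub>k\<close> with \<open>k \<ge> 1\<close>. An element killed by this derivative does not contain the letter
  (\<open>singular_avoids\<close>). For the letters \<open>L\<^bsub>-n\<^esub>\<close> the \<open>M\<^sub>k\<close> do not vanish, but
  they lower the number of such letters once more, so the formula holds for the leading part with
  respect to this number. Removing first the \<open>L\<close>, then the \<open>Y\<close>, then the \<open>M\<close>, only words in \<open>M\<^sub>0\<close> and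
  \<open>L\<^sub>0\<close> survive (\<open>singular_Cartan\<close>).

  The Poincare-Birkhoff-Witt theorem is proved for an arbitrary Lie algebra with a
  linearly ordered basis, by rewriting words: a descent \<open>x y\<close> becomes \<open>y x + [x, y]\<close>. Confluence of
  this rewriting (\<open>normal_form_relator_descent\<close>) follows from the Jacobi identity, and confluence makes
  the normal form a well-defined linear map on the enveloping algebra.
\<close>


section \<open>Words and linear maps out of the free algebra\<close>

definition mon :: "'i list \<Rightarrow> 'i free_alg"
  where "mon w = Poly_Mapping.single (Word w) 1"

lemma mon_Nil: "mon [] = 1"
  by (simp add: mon_def flip: zero_word_def)

lemma mon_append: "mon (u @ v) = mon u * mon v"
  by (simp add: mon_def mult_single plus_word_def)

lemma mon_Cons: "mon (x # v) = free_gen x * mon v"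
  using mon_append[of "[x]" v] by (simp add: mon_def free_gen_def)

text \<open>Linear statements about the free algebra are checked on words; keeping the scalar step
  separate from the words lets the word case be proved by induction on the list.\<close>

lemma word_poly_induct [case_names mon cscale add]:
  assumes "\<And>w. P (mon w)" "\<And>c p. P p \<Longrightarrow> P (cscale c p)" "\<And>p q. P p \<Longrightarrow> P q \<Longrightarrow> P (p + q)"
  shows "P p"
proof (induction p rule: free_alg_induct)
  case (single k a)
  have "Poly_Mapping.single k a = cscale a (mon (letters k))"
    by (simp add: mon_def cscale_single cscale_complex_def)
  then show ?case using assms(1,2) by metis
qed (rule assms(3))

definition lin_ext :: "('i list \<Rightarrow> 'v::complex_vec) \<Rightarrow> 'i free_alg \<Rightarrow> 'v"
  where "lin_ext g p = (\<Sum>w\<in>Poly_Mapping.keys p. cscale (Poly_Mapping.lookup p w) (g (letters w)))"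

lemma lin_ext_superset:
  assumes "finite A" "Poly_Mapping.keys p \<subseteq> A"
  shows "lin_ext g p = (\<Sum>w\<in>A. cscale (Poly_Mapping.lookup p w) (g (letters w)))"
  unfolding lin_ext_def using assms
  by (intro sum.mono_neutral_left) (auto simp: in_keys_iff)

lemma lin_ext_mon [simp]: "lin_ext g (mon w) = g w"
  by (simp add: lin_ext_def mon_def cscale_one)

lemma clinear_lin_ext: "clinear (lin_ext g)"
proof (rule clinearI)
  fix p q :: "'a free_alg" and c
  let ?A = "Poly_Mapping.keys p \<union> Poly_Mapping.keys q"
  have "Poly_Mapping.keys (p + q) \<subseteq> ?A" by (rule Poly_Mapping.keys_add)
  then show "lin_ext g (p + q) = lin_ext g p + lin_ext g q"
    by (subst (1 2 3) lin_ext_superset[of ?A])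
      (auto simp: lookup_add cscale_add_left sum.distrib)
  have "Poly_Mapping.keys (cscale c p) \<subseteq> Poly_Mapping.keys p"
    by (auto simp: in_keys_iff lookup_cscale cscale_complex_def)
  then show "lin_ext g (cscale c p) = cscale c (lin_ext g p)"
    by (subst (1 2) lin_ext_superset[of "Poly_Mapping.keys p"])
      (auto simp: lookup_cscale cscale_complex_def cvec.scale_sum_right cscale_cscale)
qed

lemmas lin_ext_add = clinear_add[OF clinear_lin_ext]
  and lin_ext_cscale = clinear_cscale[OF clinear_lin_ext]
  and lin_ext_diff = clinear_diff[OF clinear_lin_ext]
  and lin_ext_minus = clinear_minus[OF clinear_lin_ext]
  and lin_ext_zero = clinear_zero[OF clinear_lin_ext]

lemma mon_expansion:
  "p = (\<Sum>w\<in>Poly_Mapping.keys p. cscale (Poly_Mapping.lookup p w) (mon (letters w)))"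
proof -
  have "lin_ext mon p = p"
    by (induction p rule: word_poly_induct) (simp_all add: lin_ext_add lin_ext_cscale)
  then show ?thesis by (simp add: lin_ext_def)
qed

lemma keys_linear_comb:
  assumes "\<And>w. w \<in> Poly_Mapping.keys p \<Longrightarrow> Poly_Mapping.keys (g (letters w)) \<subseteq> S"
  shows "Poly_Mapping.keys (lin_ext g p :: 'k \<Rightarrow>\<^sub>0 complex) \<subseteq> S"
proof -
  have "Poly_Mapping.keys (lin_ext g p)
      \<subseteq> (\<Union>w\<in>Poly_Mapping.keys p. Poly_Mapping.keys (cscale (Poly_Mapping.lookup p w) (g (letters w))))"
    unfolding lin_ext_def by (rule keys_sum)
  also have "\<dots> \<subseteq> S"
    using assms by (fastforce simp: in_keys_iff lookup_cscale cscale_complex_def)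
  finally show ?thesis .
qed


section \<open>Inversions\<close>

fun inversions :: "'i::linorder list \<Rightarrow> nat" where
  "inversions [] = 0"
| "inversions (x # xs) = length (filter (\<lambda>y. y < x) xs) + inversions xs"

lemma inversions_swap_less:
  "y < x \<Longrightarrow> inversions (u @ y # x # v) < inversions (u @ x # y # v)"
  by (induction u) auto

lemma length_inversions_induct [case_names less]:
  assumes "\<And>w. (\<And>w'. (w', w) \<in> measures [length, inversions] \<Longrightarrow> P w') \<Longrightarrow> P w"
  shows "P w"
  using assms by (rule wf_induct_rule[OF wf_measures])

text \<open>The leftmost descent. Any other descent of the same word then lies to its right, which
  leaves only an overlapping and a disjoint position to compare in the confluence argument.\<close>

definition descent :: "'i::linorder list \<Rightarrow> nat" where
  "descent w = (LEAST i. Suc i < length w \<and> w ! Suc i < w ! i)"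

lemma descent_split:
  assumes "\<not> sorted w"
  obtains u x y v where "w = u @ x # y # v" "y < x" "descent w = length u"
proof -
  let ?P = "\<lambda>i. Suc i < length w \<and> w ! Suc i < w ! i"
  have "\<exists>i. ?P i" using assms by (auto simp: sorted_iff_nth_Suc not_le)
  then have P: "?P (descent w)" unfolding descent_def by (rule LeastI_ex)
  then have "w = take (descent w) w @ w ! descent w # w ! Suc (descent w) # drop (Suc (Suc (descent w))) w"
    by (metis Cons_nth_drop_Suc Suc_lessD id_take_nth_drop)
  with P show ?thesis by (intro that) auto
qed

lemma descent_le: "y < x \<Longrightarrow> descent (u @ x # y # v) \<le> length u"
  unfolding descent_def by (rule Least_le) (simp add: nth_append)


section \<open>The Poincare-Birkhoff-Witt theorem\<close>

text \<open>A Lie algebra with a linearly ordered basis \<open>b\<close>; \<open>coord\<close> are the coordinates with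
  respect to it. Injectivity of \<open>coord\<close> expresses that \<open>b\<close> spans.\<close>

locale lie_basis =
  fixes b :: "'i::linorder \<Rightarrow> 'a::complex_lie" and coord :: "'a \<Rightarrow> 'i \<Rightarrow>\<^sub>0 complex"
  assumes coord_add: "coord (x + y) = coord x + coord y"
    and coord_cscale: "coord (cscale c x) = cscale c (coord x)"
    and coord_b: "coord (b i) = Poly_Mapping.single i 1"
    and inj_coord: "inj coord"
begin

definition lin :: "'a \<Rightarrow> 'i free_alg"
  where "lin a = (\<Sum>i\<in>Poly_Mapping.keys (coord a). cscale (Poly_Mapping.lookup (coord a) i) (free_gen i))"

lemma lin_superset:
  assumes "finite A" "Poly_Mapping.keys (coord a) \<subseteq> A"
  shows "lin a = (\<Sum>i\<in>A. cscale (Poly_Mapping.lookup (coord a) i) (free_gen i))"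
  unfolding lin_def using assms
  by (intro sum.mono_neutral_left) (auto simp: in_keys_iff)

lemma clinear_lin: "clinear lin"
proof (rule clinearI)
  fix x y :: 'a and c
  let ?A = "Poly_Mapping.keys (coord x) \<union> Poly_Mapping.keys (coord y)"
  have "Poly_Mapping.keys (coord (x + y)) \<subseteq> ?A" unfolding coord_add by (rule Poly_Mapping.keys_add)
  then show "lin (x + y) = lin x + lin y"
    by (subst (1 2 3) lin_superset[of ?A])
      (auto simp: coord_add lookup_add cscale_add_left sum.distrib)
  have "Poly_Mapping.keys (coord (cscale c x)) \<subseteq> Poly_Mapping.keys (coord x)"
    by (auto simp: coord_cscale in_keys_iff lookup_cscale cscale_complex_def)
  then show "lin (cscale c x) = cscale c (lin x)"
    by (subst (1 2) lin_superset[of "Poly_Mapping.keys (coord x)"])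
      (auto simp: coord_cscale lookup_cscale cscale_complex_def cvec.scale_sum_right cscale_cscale)
qed

lemma lin_b [simp]: "lin (b i) = free_gen i"
  by (simp add: lin_def coord_b cscale_one)

lemma clinear_coord: "clinear coord"
  by (rule clinearI) (simp_all add: coord_add coord_cscale)

lemma basis_expansion:
  "a = (\<Sum>i\<in>Poly_Mapping.keys (coord a). cscale (Poly_Mapping.lookup (coord a) i) (b i))"
proof (rule injD[OF inj_coord], rule poly_mapping_eqI)
  fix k
  have "Poly_Mapping.lookup (coord (\<Sum>i\<in>Poly_Mapping.keys (coord a).
      cscale (Poly_Mapping.lookup (coord a) i) (b i))) k
    = (\<Sum>i\<in>Poly_Mapping.keys (coord a). if i = k then Poly_Mapping.lookup (coord a) i else 0)"
    by (simp add: clinear_sum[OF clinear_coord] lookup_sum coord_cscale coord_b lookup_cscale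
        lookup_single cscale_complex_def when_def if_distrib cong: if_cong)
  also have "\<dots> = Poly_Mapping.lookup (coord a) k"
    by (simp add: in_keys_iff)
  finally show "Poly_Mapping.lookup (coord a) k = Poly_Mapping.lookup (coord (\<Sum>i\<in>Poly_Mapping.keys (coord a).
      cscale (Poly_Mapping.lookup (coord a) i) (b i))) k" by simp
qed

lemma basis_induct [case_names scale add]:
  assumes "\<And>c i. P (cscale c (b i))" "\<And>x y. P x \<Longrightarrow> P y \<Longrightarrow> P (x + y)"
  shows "P a"
proof -
  have P0: "P 0" using assms(1)[of 0] by simp
  have "P (\<Sum>i\<in>A. cscale (f i) (b i))" if "finite A" for f A
    using that by (induction A) (auto intro: assms P0)
  then show ?thesis using basis_expansion by (metis finite_keys)
qed

abbreviation struct :: "'i \<Rightarrow> 'i \<Rightarrow> 'i \<Rightarrow>\<^sub>0 complex"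
  where "struct x y \<equiv> coord (lie_bracket (b x) (b y))"

text \<open>Rewriting a word into ordered words: the leftmost descent \<open>x y\<close> is replaced by
  \<open>y x + [x, y]\<close>. The swapped word has fewer inversions, the words from the bracket are shorter,
  so the rewriting terminates.\<close>

function sort_word :: "'i list \<Rightarrow> 'i free_alg" where
  "sort_word w = (if sorted w then mon w else
    let n = descent w; u = take n w; x = w ! n; y = w ! Suc n; v = drop (Suc (Suc n)) w
    in sort_word (u @ y # x # v)
      + (\<Sum>k\<in>Poly_Mapping.keys (struct x y). cscale (Poly_Mapping.lookup (struct x y) k) (sort_word (u @ k # v))))"
  by auto
termination
proof (relation "measures [length, inversions]", goal_cases)
  case (2 w n u x y v)
  then show ?case
    by (elim descent_split) (auto simp: nth_append inversions_swap_less)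
next
  case (3 w n u x y v k)
  then show ?case
    by (elim descent_split) (auto simp: nth_append)
qed auto

declare sort_word.simps [simp del]

lemma sort_word_sorted: "sorted w \<Longrightarrow> sort_word w = mon w"
  by (subst sort_word.simps) simp

abbreviation normal_form :: "'i free_alg \<Rightarrow> 'i free_alg"
  where "normal_form \<equiv> lin_ext sort_word"

lemma normal_form_lin:
  "normal_form (mon u * lin a * mon v) =
    (\<Sum>k\<in>Poly_Mapping.keys (coord a). cscale (Poly_Mapping.lookup (coord a) k) (sort_word (u @ k # v)))"
proof -
  have "mon u * lin a * mon v = (\<Sum>k\<in>Poly_Mapping.keys (coord a).
      cscale (Poly_Mapping.lookup (coord a) k) (mon (u @ k # v)))"
    by (simp add: lin_def sum_distrib_left sum_distrib_right cscale_mult_left cscale_mult_right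
        mon_append mon_Cons mult.assoc)
  then show ?thesis
    by (simp add: clinear_sum[OF clinear_lin_ext] lin_ext_cscale)
qed

lemma sort_word_descent:
  assumes "y < x" "descent (u @ x # y # v) = length u"
  shows "sort_word (u @ x # y # v) = sort_word (u @ y # x # v)
      + normal_form (mon u * lin (lie_bracket (b x) (b y)) * mon v)"
  using assms
  by (subst sort_word.simps) (auto simp: nth_append normal_form_lin sorted_append)

text \<open>The elements that must vanish for the free algebra on the basis to become the enveloping
  algebra. They are bilinear in their arguments, so identities between them can be used for
  arbitrary Lie algebra elements, in particular for brackets of basis elements.\<close>

definition relator :: "'a \<Rightarrow> 'a \<Rightarrow> 'i free_alg"
  where "relator x y = lin x * lin y - lin y * lin x - lin (lie_bracket x y)"

lemma lie_bracket_skew: "lie_bracket y x = - lie_bracket x (y::'a)"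
proof -
  have "lie_bracket x x + lie_bracket y x + (lie_bracket x y + lie_bracket y y) = 0"
    using lie_self[of "x + y"] unfolding lie_add_left lie_add_right .
  then have "lie_bracket y x + lie_bracket x y = 0" by (simp add: lie_self)
  then show ?thesis by (simp add: eq_neg_iff_add_eq_0 add.commute)
qed

lemma relator_skew: "relator y x = - relator x y"
  by (simp add: relator_def lie_bracket_skew[of y x] clinear_minus[OF clinear_lin])

lemma relator_self: "relator x x = 0"
  by (simp add: relator_def lie_self clinear_zero[OF clinear_lin])

lemmas relator_linear = relator_def lie_add_left lie_add_right lie_scale_left lie_scale_right
  clinear_add[OF clinear_lin] clinear_cscale[OF clinear_lin] cscale_mult_left cscale_mult_right
  cvec.scale_right_diff_distrib

lemma relator_add_left: "relator (x + x') y = relator x y + relator x' y"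
  and relator_add_right: "relator y (x + x') = relator y x + relator y x'"
  and relator_cscale_left: "relator (cscale c x) y = cscale c (relator x y)"
  and relator_cscale_right: "relator x (cscale c y) = cscale c (relator x y)"
  by (simp_all add: relator_linear algebra_simps)

text \<open>The Jacobi identity for commutators in the free algebra, minus the Jacobi identity in the
  Lie algebra: this is what resolves an overlap of two descents \<open>x y\<close> and \<open>y z\<close>.\<close>

lemma relator_jacobi:
  "lin x * relator y z - relator y z * lin x + (lin y * relator z x - relator z x * lin y)
    + (lin z * relator x y - relator x y * lin z)
    = - (relator x (lie_bracket y z) + relator y (lie_bracket z x) + relator z (lie_bracket x y))"
proof -
  have "lin (lie_bracket x (lie_bracket y z)) + lin (lie_bracket y (lie_bracket z x))
      + lin (lie_bracket z (lie_bracket x y)) = 0"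
    by (simp only: clinear_add[OF clinear_lin, symmetric] lie_jacobi clinear_zero[OF clinear_lin])
  then have "lin (lie_bracket z (lie_bracket x y)) =
      - lin (lie_bracket x (lie_bracket y z)) - lin (lie_bracket y (lie_bracket z x))"
    by (simp add: eq_neg_iff_add_eq_0 algebra_simps)
  then show ?thesis by (simp add: relator_def algebra_simps)
qed

lemma normal_form_relator_bilinear:
  assumes "\<And>i j. normal_form (p * relator (b i) (b j) * q) = 0"
  shows "normal_form (p * relator x y * q) = 0"
proof (induction x rule: basis_induct)
  case (scale c i)
  show ?case
  proof (induction y rule: basis_induct)
    case (scale d j)
    then show ?case using assms
      by (simp add: relator_cscale_left relator_cscale_right cscale_mult_left cscale_mult_right lin_ext_cscale)
  qed (simp add: relator_add_right distrib_left distrib_right lin_ext_add)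
qed (simp add: relator_add_left distrib_left distrib_right lin_ext_add)

lemma normal_form_lin_cong:
  assumes "\<And>i. normal_form (p * free_gen i * q) = 0"
  shows "normal_form (p * lin a * q) = 0"
  using assms
  by (induction a rule: basis_induct)
    (simp_all add: clinear_add[OF clinear_lin] clinear_cscale[OF clinear_lin] distrib_left distrib_right
      lin_ext_add lin_ext_cscale cscale_mult_left cscale_mult_right)

text \<open>Confluence: the rewriting step gives the same result at every descent, not only at the
  leftmost one. By induction along the rewriting order all relators in smaller words are already
  killed. If the descent \<open>x y\<close> does not meet the leftmost descent \<open>x1 y1\<close>, both steps commute up to
  such relators. If they overlap in \<open>x1 x y\<close>, the lemma \<open>relator_jacobi\<close> expresses the difference
  through relators in words with fewer inversions and in shorter words.\<close>

lemma normal_form_relator_descent: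
  assumes "y < x"
  shows "normal_form (mon u * relator (b x) (b y) * mon v) = 0"
  using assms
proof (induction "u @ x # y # v" arbitrary: u x y v
    rule: length_inversions_induct)
  case less
  note IH = less(1)
  let ?w = "u @ x # y # v"
  have swap: "normal_form (mon u' * relator (b x') (b y') * mon v') = 0"
    if "length (u' @ x' # y' # v') = length ?w"
      "inversions (u' @ x' # y' # v') < inversions ?w" "y' < x'" for u' x' y' v'
    using that by (intro IH) auto
  \<comment> \<open>shorter words, where the two letters need not form a descent\<close>
  have short_basis: "normal_form (mon u' * relator (b x') (b y') * mon v') = 0"
    if "length u' + length v' + 2 < length ?w" for u' x' y' v'
  proof (cases x' y' rule: linorder_cases)
    case equal
    then show ?thesis by (simp add: relator_self lin_ext_zero)
  next
    case greater
    then show ?thesis using that by (intro IH) auto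
  next
    case gt: less
    then have "normal_form (mon u' * relator (b y') (b x') * mon v') = 0"
      using that by (intro IH) auto
    then show ?thesis by (subst relator_skew) (simp add: lin_ext_minus)
  qed
  have short: "normal_form (mon u' * relator a c * mon v') = 0"
    if "length u' + length v' + 2 < length ?w" for u' v' a c
    using short_basis[OF that] by (rule normal_form_relator_bilinear)
  have "\<not> sorted ?w" using \<open>y < x\<close> by (auto simp: sorted_append)
  then obtain u1 x1 y1 v1 where w1: "?w = u1 @ x1 # y1 # v1" and "y1 < x1" and d1: "descent ?w = length u1"
    by (rule descent_split)
  have first: "normal_form (mon u1 * relator (b x1) (b y1) * mon v1) = 0"
  proof -
    have "normal_form (mon (u1 @ x1 # y1 # v1)) = normal_form (mon (u1 @ y1 # x1 # v1))
      + normal_form (mon u1 * lin (lie_bracket (b x1) (b y1)) * mon v1)"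
      using sort_word_descent[of y1 x1 u1 v1] \<open>y1 < x1\<close> d1 w1 by simp
    then show ?thesis
      by (simp add: relator_def mon_append mon_Cons lin_ext_diff lin_ext_add algebra_simps)
  qed
  have "length u1 \<le> length u" using descent_le[OF \<open>y < x\<close>, of u v] d1 by simp
  then consider (same) "length u = length u1" | (overlap) "length u = Suc (length u1)"
    | (disjoint) "length u \<ge> length u1 + 2" by linarith
  then show ?case
  proof cases
    case same
    then have "u1 = u" "x1 = x" "y1 = y" "v1 = v" using w1 by auto
    with first show ?thesis by simp
  next
    case overlap
    then have u: "u = u1 @ [x1]" and y1: "y1 = x" and v1: "v1 = y # v"
      using w1 by (auto simp: append_eq_append_conv2 Cons_eq_append_conv append_eq_Cons_conv)
    have "x < x1" using \<open>y1 < x1\<close> y1 by simp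
    have w: "?w = u1 @ x1 # x # y # v" using u by simp
    let ?X = "lin (b x1)" and ?Y = "lin (b x)" and ?Z = "lin (b y)"
    have inv: "inversions (u1 @ x # x1 # y # v) < inversions ?w"
      "inversions (u1 @ x1 # y # x # v) < inversions ?w"
      using inversions_swap_less[OF \<open>x < x1\<close>, of u1 "y # v"]
        inversions_swap_less[OF \<open>y < x\<close>, of "u1 @ [x1]" v] w by auto
    have "y < x1" using \<open>x < x1\<close> \<open>y < x\<close> by simp
    have inv2: "inversions (u1 @ x # y # x1 # v) < inversions ?w"
      "inversions (u1 @ y # x1 # x # v) < inversions ?w"
      using inversions_swap_less[of y x1 "u1 @ [x]" v] inversions_swap_less[of y x1 u1 "x # v"]
        inv \<open>y < x1\<close> by auto
    have z: "normal_form (mon u1 * relator (b x) (b y) * ?X * mon v) = 0"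
      "normal_form (mon u1 * ?Y * relator (b x1) (b y) * mon v) = 0"
      "normal_form (mon u1 * relator (b x1) (b y) * ?Y * mon v) = 0"
      "normal_form (mon u1 * ?Z * relator (b x1) (b x) * mon v) = 0"
      "normal_form (mon u1 * relator (b x1) (b x) * ?Z * mon v) = 0"
      using swap[of u1 x y "x1 # v"] swap[of "u1 @ [x]" x1 y v] swap[of u1 x1 y "x # v"]
        swap[of "u1 @ [y]" x1 x v] first inv inv2 \<open>x < x1\<close> \<open>y < x\<close> \<open>y < x1\<close> w y1 v1
      by (simp_all add: mon_append mon_Cons mon_Nil mult.assoc)
    have s: "normal_form (mon u1 * relator a c * mon v) = 0" for a c
      by (rule short) (simp add: w)
    \<comment> \<open>each summand on the right is a relator inside a smaller word or the step at the leftmost descent\<close>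
    have "?X * relator (b x) (b y) = relator (b x) (b y) * ?X + (?Y * relator (b x1) (b y) - relator (b x1) (b y) * ?Y)
      - (?Z * relator (b x1) (b x) - relator (b x1) (b x) * ?Z)
      - relator (b x1) (lie_bracket (b x) (b y)) - relator (b x) (lie_bracket (b y) (b x1))
      - relator (b y) (lie_bracket (b x1) (b x))"
      using relator_jacobi[of "b x1" "b x" "b y"]
      unfolding relator_skew[of "b y" "b x1"] by (simp add: algebra_simps)
    then have "mon u * relator (b x) (b y) * mon v = mon u1 * \<dots> * mon v"
      unfolding u mon_append by (simp add: mon_Cons mon_Nil mult.assoc)
    then show ?thesis
      by (simp only: distrib_left distrib_right left_diff_distrib right_diff_distrib
          lin_ext_add lin_ext_diff mult.assoc[symmetric] z s) simp
  next
    case disjoint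
    have "\<exists>t. u = u1 @ x1 # y1 # t \<and> v1 = t @ x # y # v"
    proof -
      have "take (length u1) u = u1" "drop (length u1) u @ x # y # v = x1 # y1 # v1"
        using arg_cong[OF w1, of "take (length u1)"] arg_cong[OF w1, of "drop (length u1)"] disjoint by simp_all
      moreover have "length (drop (length u1) u) \<ge> 2" using disjoint by simp
      ultimately obtain t where "drop (length u1) u = x1 # y1 # t"
        by (cases "drop (length u1) u"; cases "tl (drop (length u1) u)") auto
      with \<open>take (length u1) u = u1\<close> \<open>drop (length u1) u @ x # y # v = x1 # y1 # v1\<close> show ?thesis by (metis append_Cons append_take_drop_id list.inject)
    qed
    then obtain t where u: "u = u1 @ x1 # y1 # t" and v1: "v1 = t @ x # y # v" by blast
    have w: "?w = u1 @ x1 # y1 # t @ x # y # v" using u by simp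
    let ?U = "mon u1" and ?T = "mon t" and ?V = "mon v"
      and ?B = "relator (b x) (b y)" and ?B1 = "relator (b x1) (b y1)"
    have inv: "inversions (u1 @ y1 # x1 # t @ x # y # v) < inversions ?w"
      "inversions (u1 @ x1 # y1 # t @ y # x # v) < inversions ?w"
      using inversions_swap_less[OF \<open>y1 < x1\<close>, of u1 "t @ x # y # v"]
        inversions_swap_less[OF \<open>y < x\<close>, of "u1 @ x1 # y1 # t" v] w by auto
    have a: "normal_form (?U * free_gen y1 * free_gen x1 * ?T * ?B * ?V) = 0"
      using swap[of "u1 @ y1 # x1 # t" x y v] inv \<open>y < x\<close> w
      by (simp add: mon_append mon_Cons mult.assoc)
    have c: "normal_form (?U * ?B1 * ?T * free_gen y * free_gen x * ?V) = 0"
      using swap[of u1 x1 y1 "t @ y # x # v"] inv \<open>y1 < x1\<close> w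
      by (simp add: mon_append mon_Cons mult.assoc)
    have d: "normal_form (?U * ?B1 * ?T * free_gen x * free_gen y * ?V) = 0"
      using first unfolding v1 by (simp add: mon_append mon_Cons mult.assoc)
    have e: "normal_form (?U * lin c * (?T * ?B * ?V)) = 0" for c
    proof (rule normal_form_lin_cong)
      show "normal_form (?U * free_gen i * (?T * ?B * ?V)) = 0" for i
        using short[of "u1 @ i # t" v "b x" "b y"] w
        by (simp add: mon_append mon_Cons mult.assoc)
    qed
    have f: "normal_form (?U * ?B1 * ?T * lin c * ?V) = 0" for c
    proof (rule normal_form_lin_cong)
      show "normal_form (?U * ?B1 * ?T * free_gen i * ?V) = 0" for i
        using short[of u1 "t @ i # v" "b x1" "b y1"] w
        by (simp add: mon_append mon_Cons mult.assoc)
    qed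
    have "mon u * ?B * ?V = ?U * (free_gen x1 * free_gen y1) * ?T * ?B * ?V"
      unfolding u mon_append by (simp add: mon_Cons mult.assoc)
    \<comment> \<open>first resolve the leftmost descent, then, in the term carrying its relator, the other one\<close>
    also have "free_gen x1 * free_gen y1 = ?B1 + free_gen y1 * free_gen x1 + lin (lie_bracket (b x1) (b y1))"
      by (simp add: relator_def)
    also have "?U * \<dots> * ?T * ?B * ?V = ?U * ?B1 * ?T * ?B * ?V + ?U * free_gen y1 * free_gen x1 * ?T * ?B * ?V
      + ?U * lin (lie_bracket (b x1) (b y1)) * (?T * ?B * ?V)"
      by (simp add: distrib_left distrib_right mult.assoc)
    also have "?U * ?B1 * ?T * ?B * ?V = ?U * ?B1 * ?T * free_gen x * free_gen y * ?V
      - ?U * ?B1 * ?T * free_gen y * free_gen x * ?V - ?U * ?B1 * ?T * lin (lie_bracket (b x) (b y)) * ?V"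
      unfolding relator_def[of "b x" "b y"] by (simp add: algebra_simps)
    finally show ?thesis by (simp only: lin_ext_add lin_ext_diff a c d e f) simp
  qed
qed

lemma normal_form_relator: "normal_form (p * relator x y * q) = 0"
proof (rule normal_form_relator_bilinear)
  fix i j
  have mons: "normal_form (mon u * relator (b i) (b j) * mon v) = 0" for u v
  proof (cases i j rule: linorder_cases)
    case equal
    then show ?thesis by (simp add: relator_self lin_ext_zero)
  next
    case greater
    then show ?thesis by (rule normal_form_relator_descent)
  next
    case less
    then show ?thesis
      using normal_form_relator_descent[of i j u v] by (subst relator_skew) (simp add: lin_ext_minus)
  qed
  have mons2: "normal_form (mon u * relator (b i) (b j) * q) = 0" for u
    by (induction q rule: word_poly_induct)
      (simp_all add: mons distrib_left cscale_mult_right lin_ext_add lin_ext_cscale)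
  show "normal_form (p * relator (b i) (b j) * q) = 0"
    by (induction p rule: word_poly_induct)
      (simp_all add: mons2 distrib_right cscale_mult_left lin_ext_add lin_ext_cscale)
qed

text \<open>Evaluation of polynomials in the basis letters. It is onto the enveloping algebra, and the
  two halves of the PBW theorem say that it is a bijection on the span of the ordered words:
  rewriting does not change the value, and polynomials of equal value have equal normal forms.\<close>

definition basis_eval :: "'i free_alg \<Rightarrow> 'a uea"
  where "basis_eval = free_eval (\<lambda>i. uea_of (b i))"

lemma basis_eval_simps [simp]:
  "basis_eval (p + q) = basis_eval p + basis_eval q"
  "basis_eval (p - q) = basis_eval p - basis_eval q"
  "basis_eval (p * q) = basis_eval p * basis_eval q"
  "basis_eval (cscale c p) = cscale c (basis_eval p)"
  "basis_eval 1 = 1"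
  "basis_eval (free_gen i) = uea_of (b i)"
  by (simp_all add: basis_eval_def free_eval_add free_eval_diff free_eval_mult free_eval_cscale
      free_eval_one free_eval_gen)

lemma clinear_basis_eval: "clinear basis_eval"
  by (rule clinearI) simp_all

lemma clinear_uea_of: "clinear (uea_of :: 'a \<Rightarrow> _)"
  using lie_to_alg_hom_uea_of by (auto simp: lie_to_alg_hom_def)

lemma basis_eval_lin: "basis_eval (lin a) = uea_of a"
  by (induction a rule: basis_induct)
    (simp_all add: clinear_add[OF clinear_lin] clinear_cscale[OF clinear_lin]
      clinear_add[OF clinear_uea_of] clinear_cscale[OF clinear_uea_of])

lemma abs_uea_basis_eval: "abs_uea p = basis_eval (free_eval lin p)"
proof (induction p rule: free_alg_induct)
  case (single w c)
  have abs_mon: "abs_uea (mon l) = basis_eval (free_eval lin (mon l))" for l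
  proof (induction l)
    case Nil
    show ?case by (simp add: mon_Nil free_eval_one flip: one_uea.abs_eq)
  next
    case (Cons a l)
    then show ?case
      by (simp add: mon_Cons free_eval_mult free_eval_gen basis_eval_lin uea_of.abs_eq flip: times_uea.abs_eq)
  qed
  have "Poly_Mapping.single w c = cscale c (mon (letters w))"
    by (simp add: mon_def cscale_single cscale_complex_def)
  then show ?case
    by (simp only: cscale_uea.abs_eq[symmetric] abs_mon free_eval_cscale basis_eval_simps)
next
  case (add p q)
  then show ?case by (simp add: free_eval_add flip: plus_uea.abs_eq)
qed

lemma basis_eval_surj: "\<exists>p. u = basis_eval p"
  by (metis Quotient3_abs_rep[OF Quotient3_uea] abs_uea_basis_eval)

text \<open>The ideal of the enveloping algebra is generated by elements that expand to zero or to a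
  relator, and relators are killed by \<open>normal_form\<close> inside any product.\<close>

lemma uea_ideal_normal_form:
  assumes "p \<in> uea_ideal"
  shows "normal_form (free_eval lin p) = 0"
proof -
  have "p \<in> two_sided_ideal hull uea_relators" using assms by (simp add: uea_ideal_def)
  then have "\<forall>r s. normal_form (r * free_eval lin p * s) = 0"
  proof (rule hull_induct)
    show "\<forall>r s. normal_form (r * free_eval lin p * s) = 0" if "p \<in> uea_relators" for p
    proof -
      have "free_eval lin p = 0 \<or> (\<exists>x y. free_eval lin p = relator x y)"
      proof -
        from that consider (lin) "free_eval lin p = 0" | (bracket) x y where
          "p = free_gen x * free_gen y - free_gen y * free_gen x - free_gen (lie_bracket x y)"
          unfolding uea_relators_def
          by (auto simp: free_eval_diff free_eval_gen free_eval_cscale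
              clinear_add[OF clinear_lin] clinear_cscale[OF clinear_lin])
        then show ?thesis
          by cases (auto simp: free_eval_diff free_eval_mult free_eval_gen simp flip: relator_def)
      qed
      then show ?thesis using normal_form_relator by (auto simp: lin_ext_zero)
    qed
    let ?K = "{p. \<forall>r s. normal_form (r * free_eval lin p * s) = 0}"
    show "two_sided_ideal ?K"
      unfolding two_sided_ideal_def
    proof (intro conjI ballI allI)
      show "0 \<in> ?K" using free_eval_diff[of lin 0 0] by (simp add: lin_ext_zero)
      fix x assume x: "x \<in> ?K"
      show "x + y \<in> ?K" if "y \<in> ?K" for y
        using x that by (simp add: free_eval_add distrib_left distrib_right lin_ext_add)
      show "a * x \<in> ?K" for a
        using x by (simp add: free_eval_mult mult.assoc[symmetric])
      show "x * a \<in> ?K" for a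
        using x by (simp add: free_eval_mult mult.assoc)
    qed
  qed
  then have "normal_form (1 * free_eval lin p * 1) = 0" by blast
  then show ?thesis by simp
qed

lemma free_eval_lin_embed: "\<exists>q. abs_uea q = basis_eval p \<and> free_eval lin q = p"
proof (induction p rule: word_poly_induct)
  case (mon w)
  have "free_eval lin (mon (map b w)) = mon w"
    by (induction w) (simp_all add: mon_Nil free_eval_one mon_Cons free_eval_mult free_eval_gen)
  then show ?case using abs_uea_basis_eval by metis
next
  case (cscale c p)
  then show ?case by (metis abs_uea_basis_eval free_eval_cscale)
next
  case (add p q)
  then show ?case by (metis abs_uea_basis_eval free_eval_add)
qed

lemma normal_form_kernel:
  assumes "basis_eval p = basis_eval q"
  shows "normal_form p = normal_form q"
proof -
  obtain p' q' where "abs_uea p' = basis_eval p" "free_eval lin p' = p"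
    "abs_uea q' = basis_eval q" "free_eval lin q' = q"
    using free_eval_lin_embed by metis
  then have "uea_rel p' q'" using assms by (metis uea.abs_eq_iff)
  then have "normal_form (free_eval lin (p' - q')) = 0"
    by (intro uea_ideal_normal_form) (simp add: uea_rel_def)
  then show ?thesis
    using \<open>free_eval lin p' = p\<close> \<open>free_eval lin q' = q\<close> by (simp add: free_eval_diff lin_ext_diff)
qed

lemma sort_word_induct [case_names sorted descent]:
  assumes "\<And>w. sorted w \<Longrightarrow> P w"
    and "\<And>u x y v. \<lbrakk>y < x; P (u @ y # x # v); \<And>k. k \<in> Poly_Mapping.keys (struct x y) \<Longrightarrow> P (u @ k # v)\<rbrakk>
      \<Longrightarrow> P (u @ x # y # v)"
  shows "P w"
proof (induction w rule: length_inversions_induct)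
  case (less w)
  show ?case
  proof (cases "sorted w")
    case False
    then obtain u x y v where w: "w = u @ x # y # v" and "y < x" by (rule descent_split)
    show ?thesis
      unfolding w using \<open>y < x\<close>
    proof (rule assms(2))
      show "P (u @ y # x # v)"
        using \<open>y < x\<close> by (intro less) (simp add: w inversions_swap_less)
      show "P (u @ k # v)" for k by (rule less) (simp add: w)
    qed
  qed (rule assms(1))
qed

text \<open>By confluence the defining equation of \<open>sort_word\<close> holds at every position, whether or not
  it is a descent.\<close>

lemma sort_word_swap:
  "sort_word (u @ x # y # v) = sort_word (u @ y # x # v)
      + (\<Sum>k\<in>Poly_Mapping.keys (struct x y). cscale (Poly_Mapping.lookup (struct x y) k) (sort_word (u @ k # v)))"
proof -
  have "normal_form (mon (u @ x # y # v)) = normal_form (mon (u @ y # x # v))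
      + normal_form (mon u * lin (lie_bracket (b x) (b y)) * mon v)"
    using normal_form_relator[of "mon u" "b x" "b y" "mon v"]
    by (simp add: relator_def mon_append mon_Cons lin_ext_diff lin_ext_add algebra_simps del: lin_ext_mon)
  then show ?thesis by (simp add: normal_form_lin)
qed

lemma basis_eval_normal_form: "basis_eval (normal_form p) = basis_eval p"
proof -
  have word: "basis_eval (sort_word w) = basis_eval (mon w)" for w
  proof (induction w rule: sort_word_induct)
    case (descent u x y v)
    let ?c = "struct x y"
    have "basis_eval (sort_word (u @ x # y # v)) = basis_eval (mon (u @ y # x # v))
      + (\<Sum>k\<in>Poly_Mapping.keys ?c. cscale (Poly_Mapping.lookup ?c k) (basis_eval (mon (u @ k # v))))"
      using descent by (subst sort_word_swap) (simp add: clinear_sum[OF clinear_basis_eval])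
    also have "(\<Sum>k\<in>Poly_Mapping.keys ?c. cscale (Poly_Mapping.lookup ?c k) (basis_eval (mon (u @ k # v))))
      = basis_eval (mon u * lin (lie_bracket (b x) (b y)) * mon v)"
      by (simp add: lin_def clinear_sum[OF clinear_basis_eval] sum_distrib_left sum_distrib_right
          cscale_mult_left cscale_mult_right mon_append mon_Cons mult.assoc)
    also have "\<dots> = basis_eval (mon (u @ x # y # v)) - basis_eval (mon (u @ y # x # v))"
    proof -
      have "uea_of (lie_bracket (b x) (b y)) = uea_of (b x) * uea_of (b y) - uea_of (b y) * uea_of (b x)"
        using lie_to_alg_hom_uea_of[where 'a = 'a] unfolding lie_to_alg_hom_def by blast
      then show ?thesis
        by (simp add: basis_eval_lin mon_append mon_Cons left_diff_distrib right_diff_distrib mult.assoc)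
    qed
    finally show ?case by simp
  qed (simp add: sort_word_sorted)
  show ?thesis
    by (induction p rule: word_poly_induct) (simp_all add: word lin_ext_add lin_ext_cscale)
qed


text \<open>An invariant \<open>I\<close> of words that survives both kinds of rewriting step holds for all ordered
  words that occur in the normal form.\<close>

lemma sort_word_keys:
  assumes sorted: "\<And>w. sorted w \<Longrightarrow> I w \<Longrightarrow> Q w"
    and swap: "\<And>u x y v. I (u @ x # y # v) \<Longrightarrow> y < x \<Longrightarrow> I (u @ y # x # v)"
    and bracket: "\<And>u x y v k. I (u @ x # y # v) \<Longrightarrow> y < x \<Longrightarrow> k \<in> Poly_Mapping.keys (struct x y) \<Longrightarrow> I (u @ k # v)"
    and "I w"
  shows "Poly_Mapping.keys (sort_word w) \<subseteq> {z. sorted (letters z) \<and> Q (letters z)}"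
  using \<open>I w\<close>
proof (induction w rule: sort_word_induct)
  case (sorted w)
  then have "Q w" by (rule assms(1))
  then show ?case using sorted(1) by (simp add: sort_word_sorted mon_def)
next
  case (descent u x y v)
  let ?c = "struct x y" and ?S = "{z. sorted (letters z) \<and> Q (letters z)}"
  have "Poly_Mapping.keys (sort_word (u @ x # y # v)) \<subseteq> Poly_Mapping.keys (sort_word (u @ y # x # v))
      \<union> Poly_Mapping.keys (\<Sum>k\<in>Poly_Mapping.keys ?c. cscale (Poly_Mapping.lookup ?c k) (sort_word (u @ k # v)))"
    by (subst sort_word_swap) (rule Poly_Mapping.keys_add)
  moreover have "Poly_Mapping.keys (sort_word (u @ y # x # v)) \<subseteq> ?S"
    by (rule descent(2)[OF swap[OF descent(4) descent(1)]])
  moreover have summand: "Poly_Mapping.keys (cscale (Poly_Mapping.lookup ?c k) (sort_word (u @ k # v))) \<subseteq> ?S"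
    if "k \<in> Poly_Mapping.keys ?c" for k
    using descent(3)[OF that bracket[OF descent(4) descent(1) that]]
    by (auto simp: in_keys_iff lookup_cscale cscale_complex_def)
  moreover have "Poly_Mapping.keys (\<Sum>k\<in>Poly_Mapping.keys ?c.
      cscale (Poly_Mapping.lookup ?c k) (sort_word (u @ k # v))) \<subseteq> ?S"
    by (rule order_trans[OF keys_sum UN_least]) (rule summand)
  ultimately show ?case by (meson Un_least order_trans)
qed

definition pbw_coords :: "'a uea \<Rightarrow> 'i free_alg"
  where "pbw_coords u = normal_form (SOME p. u = basis_eval p)"

lemma pbw_coords_basis_eval: "pbw_coords (basis_eval p) = normal_form p"
proof -
  have "basis_eval p = basis_eval (SOME q. basis_eval p = basis_eval q)"
    by (rule someI) (rule refl)
  then show ?thesis unfolding pbw_coords_def by (intro normal_form_kernel) simp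
qed

lemma basis_eval_pbw_coords: "basis_eval (pbw_coords u) = u"
  using basis_eval_surj[of u] by (auto simp: pbw_coords_basis_eval basis_eval_normal_form)

lemma clinear_pbw_coords: "clinear pbw_coords"
proof (rule clinearI)
  show "pbw_coords (u + v) = pbw_coords u + pbw_coords v" for u v
  proof -
    obtain p q where "u = basis_eval p" "v = basis_eval q" using basis_eval_surj by metis
    then show ?thesis by (simp only: basis_eval_simps[symmetric] pbw_coords_basis_eval lin_ext_add)
  qed
  show "pbw_coords (cscale c u) = cscale c (pbw_coords u)" for c u
  proof -
    obtain p where "u = basis_eval p" using basis_eval_surj by metis
    then show ?thesis by (simp only: basis_eval_simps[symmetric] pbw_coords_basis_eval lin_ext_cscale)
  qed
qed

lemma keys_pbw_coords: "Poly_Mapping.keys (pbw_coords u) \<subseteq> {z. sorted (letters z)}"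
  unfolding pbw_coords_def
  using sort_word_keys[where I = "\<lambda>_. True" and Q = "\<lambda>_. True"]
  by (intro keys_linear_comb) simp

end


section \<open>An ordered basis of the Schroedinger-Virasoro algebra\<close>

text \<open>The order of the basis is \<open>M\<^sub>0 < M\<^sub>n < Y\<^sub>n < L\<^sub>n < L\<^sub>0\<close> (with \<open>n < 0\<close>), followed by the basis of
  \<open>sv\<^sup>+\<close>. With \<open>sv\<^sup>+\<close> last, the left ideal generated by \<open>sv\<^sup>+\<close> is spanned by the ordered
  monomials whose last letter is in \<open>sv\<^sup>+\<close>. With \<open>L\<^sub>0\<close> behind all other remaining letters, a positive
  generator that reaches it is already as good as zero. With the central \<open>M\<^sub>0\<close> in front, multiplication
  by \<open>M\<^sub>0\<close> keeps monomials ordered.\<close>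

fun level :: "sv_index \<Rightarrow> nat" where
  "level (M n) = (if n = 0 then 0 else if n < 0 then 1 else 6)"
| "level (Y n) = (if n < 0 then 2 else 7)"
| "level (L n) = (if n < 0 then 3 else if n = 0 then 4 else 5)"

fun mode :: "sv_index \<Rightarrow> int" where
  "mode (L n) = n" | "mode (M n) = n" | "mode (Y n) = n"

lemma level_mode_inj: "level i = level j \<Longrightarrow> mode i = mode j \<Longrightarrow> i = j"
  by (cases i; cases j) (auto split: if_splits)

instantiation sv_index :: linorder
begin
definition less_eq_sv_index :: "sv_index \<Rightarrow> sv_index \<Rightarrow> bool"
  where "i \<le> j \<longleftrightarrow> level i < level j \<or> level i = level j \<and> mode i \<le> mode j"
definition less_sv_index :: "sv_index \<Rightarrow> sv_index \<Rightarrow> bool"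
  where "i < j \<longleftrightarrow> level i < level j \<or> level i = level j \<and> mode i < mode j"
instance
  by standard (auto simp: less_eq_sv_index_def less_sv_index_def intro: level_mode_inj)
end

abbreviation positive :: "sv_index \<Rightarrow> bool"
  where "positive i \<equiv> level i \<ge> 5"

lemma positive_upward: "positive i \<Longrightarrow> i \<le> j \<Longrightarrow> positive j"
  by (auto simp: less_eq_sv_index_def)

text \<open>The weight counts the letters \<open>L\<^sub>n\<close> with \<open>n < 0\<close>. No bracket has larger weight than its two
  arguments together, so the rewriting into ordered words does not increase it.\<close>

fun weight :: "sv_index \<Rightarrow> int" where
  "weight (L n) = (if n < 0 then 1 else 0)" | "weight (M n) = 0" | "weight (Y n) = 0"

abbreviation word_weight :: "sv_index list \<Rightarrow> int"
  where "word_weight w \<equiv> sum_list (map weight w)"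

lemma weight_nonneg: "0 \<le> weight i"
  by (cases i) auto

lemma word_weight_nonneg: "0 \<le> word_weight w"
  by (induction w) (simp_all add: weight_nonneg)

lemma basis_bracket_monomial:
  "\<exists>c k. basis_bracket i j = cscale c (sv_basis k) \<and> (positive i \<longrightarrow> positive j \<longrightarrow> positive k)
    \<and> weight k \<le> weight i + weight j"
proof (cases i; cases j)
  fix m n
  show ?thesis if "i = L m" "j = L n"
    using that by (intro exI[of _ "of_int (n - m)"] exI[of _ "L (m + n)"]) auto
  show ?thesis if "i = L m" "j = M n"
    using that by (intro exI[of _ "of_int n"] exI[of _ "M (m + n)"]) auto
  show ?thesis if "i = M m" "j = L n"
    using that by (intro exI[of _ "- of_int m"] exI[of _ "M (n + m)"]) auto
  show ?thesis if "i = L m" "j = Y n"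
    using that by (intro exI[of _ "of_int n + (1 - of_int m) / 2"] exI[of _ "Y (m + n)"]) auto
  show ?thesis if "i = Y m" "j = L n"
    using that by (intro exI[of _ "- (of_int m + (1 - of_int n) / 2)"] exI[of _ "Y (n + m)"]) (auto simp flip: cvec.scale_minus_left)
  show ?thesis if "i = Y m" "j = Y n"
    using that by (intro exI[of _ "of_int (n - m)"] exI[of _ "M (m + n + 1)"]) auto
  show ?thesis if "i = M m" "j = M n"
    using that by (intro exI[of _ 0] exI[of _ j]) auto
  show ?thesis if "i = M m" "j = Y n"
    using that by (intro exI[of _ 0] exI[of _ j]) auto
  show ?thesis if "i = Y m" "j = M n"
    using that by (intro exI[of _ 0] exI[of _ j]) auto
qed

interpretation sv: lie_basis sv_basis sv_coeffs
proof
  show "inj sv_coeffs" by (metis injI sv_coeffs_inverse)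
qed (simp_all add: plus_sv.rep_eq cscale_sv.rep_eq sv_basis.rep_eq)

lemma sv_lie_bracket_basis [simp]: "lie_bracket (sv_basis i) (sv_basis j) = basis_bracket i j"
  by (simp add: lie_bracket_sv_def)

lemma keys_sv_struct:
  assumes "k \<in> Poly_Mapping.keys (sv.struct i j)"
  shows "positive i \<Longrightarrow> positive j \<Longrightarrow> positive k" and "weight k \<le> weight i + weight j"
proof -
  obtain c k' where k': "basis_bracket i j = cscale c (sv_basis k')"
    "positive i \<longrightarrow> positive j \<longrightarrow> positive k'" "weight k' \<le> weight i + weight j"
    using basis_bracket_monomial by blast
  with assms have "k = k'"
    by (auto simp: cscale_sv.rep_eq sv_basis.rep_eq cscale_single in_keys_iff lookup_single when_def split: if_splits)
  with k' show "positive i \<Longrightarrow> positive j \<Longrightarrow> positive k" and "weight k \<le> weight i + weight j"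
    by auto
qed

abbreviation gen :: "sv_index \<Rightarrow> sv uea"
  where "gen i \<equiv> uea_of (sv_basis i)"

abbreviation monom :: "sv_index list \<Rightarrow> sv uea"
  where "monom w \<equiv> sv.basis_eval (mon w)"

definition coeff :: "sv_index list \<Rightarrow> sv uea \<Rightarrow> complex"
  where "coeff B u = Poly_Mapping.lookup (sv.pbw_coords u) (Word B)"

abbreviation nonpositive :: "sv_index list \<Rightarrow> bool"
  where "nonpositive w \<equiv> \<forall>i\<in>set w. \<not> positive i"

lemma clinear_coeff: "clinear (coeff B)"
  by (rule clinearI) (simp_all add: coeff_def clinear_add[OF sv.clinear_pbw_coords]
      clinear_cscale[OF sv.clinear_pbw_coords] lookup_add lookup_cscale)

lemmas coeff_add = clinear_add[OF clinear_coeff]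
  and coeff_diff = clinear_diff[OF clinear_coeff]
  and coeff_sum = clinear_sum[OF clinear_coeff]
  and coeff_zero = clinear_zero[OF clinear_coeff]

lemma coeff_cscale: "coeff B (cscale c u) = c * coeff B u"
  using clinear_cscale[OF clinear_coeff] by (simp add: cscale_complex_def)

lemma coeff_monom: "coeff B (monom w) = Poly_Mapping.lookup (sv.sort_word w) (Word B)"
  by (simp add: coeff_def sv.pbw_coords_basis_eval)

lemma coeff_monom_sorted: "sorted w \<Longrightarrow> coeff B (monom w) = (if w = B then 1 else 0)"
  by (simp add: coeff_monom sv.sort_word_sorted) (simp add: mon_def lookup_single when_def)

lemma coeff_weight:
  assumes "word_weight w < word_weight B"
  shows "coeff B (monom w) = 0"
proof -
  have "Poly_Mapping.keys (sv.sort_word w) \<subseteq> {z. sorted (letters z) \<and> word_weight (letters z) \<le> word_weight w}"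
    using keys_sv_struct(2)
    by (intro sv.sort_word_keys[where I = "\<lambda>z. word_weight z \<le> word_weight w"]) (force simp: algebra_simps)+
  then show ?thesis using assms by (auto simp: coeff_monom in_keys_iff)
qed

text \<open>The left ideal \<open>U(sv) sv\<^sup>+\<close>, described by its PBW coordinates; the rule
  \<open>plus_left_ideal_induct\<close> below shows that it is generated by \<open>sv\<^sup>+\<close>.\<close>

definition plus_left_ideal :: "sv uea set"
  where "plus_left_ideal = {u. \<forall>B. nonpositive B \<longrightarrow> coeff B u = 0}"

text \<open>Having a last letter in \<open>sv\<^sup>+\<close> survives the rewriting: a swap at the end moves an even larger
  letter to the end, and a bracket of two letters of \<open>sv\<^sup>+\<close> is again in \<open>sv\<^sup>+\<close>.\<close>

lemma plus_left_ideal_gen: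
  assumes "positive p"
  shows "u * gen p \<in> plus_left_ideal"
proof -
  have word: "Poly_Mapping.lookup (sv.sort_word (w @ [p])) (Word B) = 0" if "nonpositive B" for w B
  proof -
    let ?I = "\<lambda>z. z \<noteq> [] \<and> positive (last z)"
    have "Poly_Mapping.keys (sv.sort_word (w @ [p])) \<subseteq> {z. sorted (letters z) \<and> ?I (letters z)}"
    proof (rule sv.sort_word_keys[where I = ?I])
      fix x y :: sv_index and u v
      assume "?I (u @ x # y # v)" "y < x"
      then show "?I (u @ y # x # v)"
        using positive_upward[of y x] by (auto split: if_splits)
      fix k assume "k \<in> Poly_Mapping.keys (sv.struct x y)"
      then show "?I (u @ k # v)"
        using \<open>?I (u @ x # y # v)\<close> \<open>y < x\<close> keys_sv_struct(1) positive_upward[of y x]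
        by (auto split: if_splits)
    qed (use assms in auto)
    then show ?thesis using that by (force simp: in_keys_iff)
  qed
  have "Poly_Mapping.lookup (sv.normal_form (q * free_gen p)) (Word B) = 0" if "nonpositive B" for q B
  proof (induction q rule: word_poly_induct)
    case (mon w)
    have "mon w * free_gen p = mon (w @ [p])" by (simp add: mon_append mon_Cons mon_Nil)
    then show ?case using word[OF that] by simp
  qed (simp_all add: distrib_right cscale_mult_left lin_ext_add lin_ext_cscale lookup_add lookup_cscale
      cscale_complex_def)
  moreover obtain q where "u = sv.basis_eval q" using sv.basis_eval_surj by blast
  ultimately show ?thesis
    by (simp add: plus_left_ideal_def coeff_def sv.pbw_coords_basis_eval
        flip: sv.basis_eval_simps(3) sv.basis_eval_simps(6))
qed

lemma plus_left_ideal_zero: "0 \<in> plus_left_ideal"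
  and plus_left_ideal_add: "u \<in> plus_left_ideal \<Longrightarrow> v \<in> plus_left_ideal \<Longrightarrow> u + v \<in> plus_left_ideal"
  and plus_left_ideal_cscale: "u \<in> plus_left_ideal \<Longrightarrow> cscale c u \<in> plus_left_ideal"
  by (simp_all add: plus_left_ideal_def coeff_zero coeff_add coeff_cscale)

lemma monom_Cons: "monom (x # w) = gen x * monom w"
  by (simp add: mon_Cons)

lemma monom_append: "monom (u @ v) = monom u * monom v"
  by (simp add: mon_append)

lemma monom_Nil [simp]: "monom [] = 1"
  by (simp add: mon_Nil)

lemma pbw_expansion:
  "u = (\<Sum>w\<in>Poly_Mapping.keys (sv.pbw_coords u). cscale (coeff (letters w) u) (monom (letters w)))"
proof -
  have "u = sv.basis_eval (sv.pbw_coords u)" by (simp add: sv.basis_eval_pbw_coords)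
  also have "\<dots> = (\<Sum>w\<in>Poly_Mapping.keys (sv.pbw_coords u). cscale (coeff (letters w) u) (monom (letters w)))"
    by (subst mon_expansion) (simp add: clinear_sum[OF sv.clinear_basis_eval] coeff_def)
  finally show ?thesis .
qed

lemma sorted_positive_last:
  assumes "sorted w" "\<not> nonpositive w"
  obtains v p where "w = v @ [p]" "positive p"
proof -
  obtain i where "i \<in> set w" "positive i" using assms(2) by blast
  then obtain v p where w: "w = v @ [p]" by (metis append_butlast_last_id empty_iff empty_set)
  then have "i \<le> p" using assms(1) \<open>i \<in> set w\<close> by (auto simp: sorted_append)
  then show ?thesis using that w positive_upward \<open>positive i\<close> by blast
qed

lemma plus_left_ideal_induct [consumes 1, case_names zero gen add]:
  assumes "u \<in> plus_left_ideal"
    and zero: "P 0" and gen: "\<And>a p. positive p \<Longrightarrow> P (a * gen p)"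
    and add: "\<And>u v. P u \<Longrightarrow> P v \<Longrightarrow> P (u + v)"
  shows "P u"
proof -
  have summand: "P (cscale (coeff (letters w) u) (monom (letters w)))"
    if "w \<in> Poly_Mapping.keys (sv.pbw_coords u)" for w
  proof -
    have "coeff (letters w) u \<noteq> 0" using that by (simp add: coeff_def in_keys_iff)
    then have "\<not> nonpositive (letters w)" using assms(1) by (auto simp: plus_left_ideal_def)
    moreover have "sorted (letters w)" using that sv.keys_pbw_coords by blast
    ultimately obtain v p where "letters w = v @ [p]" "positive p"
      using sorted_positive_last by blast
    then show ?thesis
      using gen[of p "cscale (coeff (letters w) u) (monom v)"]
      by (simp add: monom_append monom_Cons cscale_mult_left)
  qed
  have "P (\<Sum>w\<in>A. cscale (coeff (letters w) u) (monom (letters w)))"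
    if "A \<subseteq> Poly_Mapping.keys (sv.pbw_coords u)" for A
    using finite_subset[OF that finite_keys] that
    by (induction A rule: finite_induct) (auto intro: zero add summand)
  then show ?thesis using pbw_expansion[of u] by (metis subset_refl)
qed

lemma plus_left_ideal_mult: "u \<in> plus_left_ideal \<Longrightarrow> a * u \<in> plus_left_ideal"
  by (induction rule: plus_left_ideal_induct)
    (simp_all add: plus_left_ideal_zero plus_left_ideal_gen plus_left_ideal_add distrib_left
      flip: mult.assoc)

lemma plus_left_ideal_diff: "u \<in> plus_left_ideal \<Longrightarrow> v \<in> plus_left_ideal \<Longrightarrow> u - v \<in> plus_left_ideal"
  by (simp add: plus_left_ideal_def coeff_diff)


section \<open>The induced module\<close>

text \<open>The additive extension of \<open>g\<close> to the free abelian group, used to detect nonzero tensors.\<close>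

definition frag_sum :: "('b \<Rightarrow> complex) \<Rightarrow> ('b \<Rightarrow>\<^sub>0 int) \<Rightarrow> complex"
  where "frag_sum g x = (\<Sum>k\<in>Poly_Mapping.keys x. of_int (Poly_Mapping.lookup x k) * g k)"

lemma frag_sum_of [simp]: "frag_sum g (frag_of k) = g k"
  by (simp add: frag_sum_def)

lemma frag_sum_superset:
  assumes "finite A" "Poly_Mapping.keys x \<subseteq> A"
  shows "frag_sum g x = (\<Sum>k\<in>A. of_int (Poly_Mapping.lookup x k) * g k)"
  unfolding frag_sum_def using assms
  by (intro sum.mono_neutral_left) (auto simp: in_keys_iff)

lemma frag_sum_diff: "frag_sum g (x - y) = frag_sum g x - frag_sum g y"
proof -
  let ?A = "Poly_Mapping.keys x \<union> Poly_Mapping.keys y"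
  have "Poly_Mapping.keys (x - y) \<subseteq> ?A" by (rule keys_diff)
  then show ?thesis
    by (subst (1 2 3) frag_sum_superset[of ?A])
      (auto simp: lookup_minus left_diff_distrib sum_subtractf)
qed

lemma frag_sum_tensor_relators:
  assumes "\<And>m m' n. g (m + m', n) = g (m, n) + g (m', n)"
    and "\<And>m n n'. g (m, n + n') = g (m, n) + g (m, n')"
    and "\<And>m s n. g (r m s, n) = g (m, l s n)"
    and "x \<in> additive_subgroup hull tensor_relators r l"
  shows "frag_sum g x = 0"
  using assms(4)
proof (rule hull_induct)
  show "frag_sum g x = 0" if "x \<in> tensor_relators r l" for x
    using that assms(1-3) unfolding tensor_relators_def by (auto simp: frag_sum_diff)
  show "additive_subgroup {x. frag_sum g x = 0}"
    by (auto simp: additive_subgroup_def frag_sum_diff) (simp add: frag_sum_def)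
qed

locale trivial_whittaker =
  fixes \<psi> :: "sv_plus \<Rightarrow> complex"
  assumes trivial: "\<psi> x = 0"
begin

lemma lie_to_alg_hom_trivial: "lie_to_alg_hom \<psi>"
  by (auto simp: lie_to_alg_hom_def trivial intro: clinearI)

abbreviation relations :: "(sv uea \<times> complex \<Rightarrow>\<^sub>0 int) set"
  where "relations \<equiv> additive_subgroup hull tensor_relators uea_right_act (C_psi_act \<psi>)"

abbreviation pure :: "sv uea \<Rightarrow> W_elem"
  where "pure u \<equiv> pure_tensor uea_right_act (C_psi_act \<psi>) u 1"

lemma relations_zero: "0 \<in> relations"
  and relations_diff: "x \<in> relations \<Longrightarrow> y \<in> relations \<Longrightarrow> x - y \<in> relations"
  using additive_subgroup_hull[of "tensor_relators uea_right_act (C_psi_act \<psi>)"]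
  by (auto simp: additive_subgroup_def)

lemma relations_add: "x \<in> relations \<Longrightarrow> y \<in> relations \<Longrightarrow> x + y \<in> relations"
  using relations_diff[of x "0 - y"] relations_diff[OF relations_zero, of y] by simp

lemma relations_minus: "x \<in> relations \<Longrightarrow> - x \<in> relations"
  using relations_diff[OF relations_zero] by simp

lemma relations_left: "frag_of (u + v, \<alpha>) - frag_of (u, \<alpha>) - frag_of (v, \<alpha>) \<in> relations"
  and relations_right: "frag_of (u, \<alpha> + \<beta>) - frag_of (u, \<alpha>) - frag_of (u, \<beta>) \<in> relations"
  and relations_balanced: "frag_of (u * uea_incl s, \<alpha>) - frag_of (u, uea_lift \<psi> s * \<alpha>) \<in> relations"
  by (rule hull_inc; unfold tensor_relators_def; blast)+

lemma pure_eq_iff: "pure u = pure v \<longleftrightarrow> frag_of (u, 1) - frag_of (v, 1) \<in> relations"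
  unfolding pure_tensor_def
  by (subst eq_equiv_class_iff[OF equiv_tensor_rel]) (simp_all add: tensor_rel_def)

lemma relations_zero_left: "frag_of (0, \<alpha>) \<in> relations"
  using relations_minus[OF relations_left[of 0 0 \<alpha>]] by simp

lemma relations_zero_right: "frag_of (u, 0) \<in> relations"
  using relations_minus[OF relations_right[of u 0 0]] by simp

text \<open>Scalars are in \<open>U(sv\<^sup>+)\<close>, so \<open>u \<otimes> \<alpha> = \<alpha> u \<otimes> 1\<close>.\<close>

lemma W_elem_pure:
  assumes "v \<in> W \<psi>"
  obtains u where "v = pure u"
proof -
  let ?rel = "tensor_rel uea_right_act (C_psi_act \<psi>)"
  have ex: "\<exists>u. x - frag_of (u, 1) \<in> relations" for x
    using subset_UNIV
  proof (induction x rule: frag_induction)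
    case zero
    then show ?case using relations_minus[OF relations_zero_left] by (intro exI[of _ 0]) simp
  next
    case (one k)
    obtain u \<alpha> where k: "k = (u, \<alpha>)" by force
    note incl = uea_lift_hom[OF lie_to_alg_hom_incl, folded uea_incl_def]
    have "frag_of (u * uea_incl (cscale \<alpha> 1), 1) - frag_of (u, uea_lift \<psi> (cscale \<alpha> 1) * 1) \<in> relations"
      by (rule relations_balanced)
    then have "frag_of (cscale \<alpha> u, 1) - frag_of (u, \<alpha>) \<in> relations"
      by (simp add: incl uea_lift_hom[OF lie_to_alg_hom_trivial] cscale_mult_right cscale_complex_def)
    then show ?case using k relations_minus by fastforce
  next
    case (diff x y)
    then obtain u v where u: "x - frag_of (u, 1) \<in> relations" and v: "y - frag_of (v, 1) \<in> relations" by blast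
    have uv: "frag_of (u, 1) - frag_of (u - v, 1) - frag_of (v, 1) \<in> relations"
      using relations_left[of "u - v" v 1] by simp
    have "(x - frag_of (u, 1)) - (y - frag_of (v, 1))
        + (frag_of (u, 1) - frag_of (u - v, 1) - frag_of (v, 1)) \<in> relations"
      by (rule relations_add[OF relations_diff[OF u v] uv])
    then have "x - y - frag_of (u - v, 1) \<in> relations" by (simp add: algebra_simps)
    then show ?case by blast
  qed
  obtain x where "v = ?rel `` {x}" using assms unfolding W_def tensor_prod_def by (rule quotientE)
  moreover obtain u where "x - frag_of (u, 1) \<in> relations" using ex by blast
  then have "(x, frag_of (u, 1)) \<in> ?rel" by (simp add: tensor_rel_def)
  ultimately have "v = pure u"
    unfolding pure_tensor_def using equiv_class_eq[OF equiv_tensor_rel] by metis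
  then show ?thesis by (rule that)
qed

lemma pure_in_W: "pure u \<in> W \<psi>"
  unfolding W_def tensor_prod_def pure_tensor_def by (rule quotientI) simp

lemma W_act_pure_one: "W_act \<psi> a (pure u) = pure (a * u)"
  by (rule W_act_pure)

lemma positive_sv_plus:
  assumes "positive p"
  shows "sv_basis p \<in> cvec.span sv_plus_basis"
proof -
  have "sv_basis p \<in> sv_plus_basis"
    using assms by (cases p) (auto split: if_splits)
  then show ?thesis by (rule cvec.span_base)
qed

lemma sv_plus_right_mult: "u * uea_of (sv_incl x) \<in> plus_left_ideal"
proof -
  have "u * uea_of y \<in> plus_left_ideal" if "y \<in> cvec.span sv_plus_basis" for y
    using that
  proof (induction rule: cvec.span_induct_alt)
    case base
    show ?case by (simp add: clinear_zero[OF sv.clinear_uea_of] plus_left_ideal_zero)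
  next
    case (step c y z)
    then obtain p where "y = sv_basis p" "positive p" by fastforce
    with step show ?case
      by (simp add: clinear_add[OF sv.clinear_uea_of] clinear_cscale[OF sv.clinear_uea_of] distrib_left
          cscale_mult_right plus_left_ideal_add plus_left_ideal_cscale plus_left_ideal_gen)
  qed
  then show ?thesis using sv_incl by blast
qed

text \<open>For trivial \<open>\<psi>\<close> the character of \<open>U(sv\<^sup>+)\<close> vanishes on every nonempty product, and so does the
  coordinate of a right multiple by it. Hence coordinates at nonpositive words factor
  through the tensor product.\<close>

lemma coeff_balanced:
  assumes "nonpositive B"
  shows "coeff B (u * uea_incl s) = uea_lift \<psi> s * coeff B u"
proof -
  define p where "p = rep_uea s"
  have s: "s = abs_uea p" by (simp only: p_def Quotient3_abs_rep[OF Quotient3_uea])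
  have incl: "uea_incl (abs_uea p) = free_eval (\<lambda>x. uea_of (sv_incl x)) p" for p
    unfolding uea_incl_def by (rule uea_lift_abs[OF lie_to_alg_hom_incl])
  have lift: "uea_lift \<psi> (abs_uea p) = free_eval \<psi> p" for p
    by (rule uea_lift_abs[OF lie_to_alg_hom_trivial])
  have "coeff B (u * free_eval (\<lambda>x. uea_of (sv_incl x)) p) = free_eval \<psi> p * coeff B u"
  proof (induction p rule: word_poly_induct)
    case (mon w)
    show ?case
    proof (cases w rule: rev_cases)
      case Nil
      then show ?thesis by (simp add: mon_Nil free_eval_one)
    next
      case (snoc v x)
      have "u * free_eval (\<lambda>x. uea_of (sv_incl x)) (mon v) * uea_of (sv_incl x) \<in> plus_left_ideal"
        by (rule sv_plus_right_mult)
      then have "coeff B (u * free_eval (\<lambda>x. uea_of (sv_incl x)) (mon v) * uea_of (sv_incl x)) = 0"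
        using assms unfolding plus_left_ideal_def by blast
      then show ?thesis
        by (simp add: snoc mon_append mon_Cons mon_Nil free_eval_mult free_eval_gen trivial mult.assoc)
    qed
  next
    case (cscale c p)
    then show ?case by (simp add: free_eval_cscale cscale_mult_right coeff_cscale cscale_complex_def)
  next
    case (add p q)
    then show ?case by (simp add: free_eval_add distrib_left distrib_right coeff_add)
  qed
  then show ?thesis by (simp add: s incl lift)
qed

lemma plus_left_ideal_relations:
  assumes "u \<in> plus_left_ideal"
  shows "frag_of (u, 1) \<in> relations"
  using assms
proof (induction rule: plus_left_ideal_induct)
  case zero
  show ?case by (rule relations_zero_left)
next
  case (gen a p)
  define x where "x = Abs_sv_plus (sv_basis p)"
  have x: "sv_incl x = sv_basis p"
    unfolding x_def using positive_sv_plus[OF gen] by (rule Abs_sv_plus_inverse)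
  have "uea_incl (uea_of x) = gen p"
    unfolding uea_incl_def by (simp add: uea_lift_hom[OF lie_to_alg_hom_incl] x)
  then have "frag_of (a * gen p, 1) - frag_of (a, 0) \<in> relations"
    using relations_balanced[of a "uea_of x" 1] by (simp add: uea_lift_hom[OF lie_to_alg_hom_trivial] trivial)
  then show ?case using relations_add[OF _ relations_zero_right[of a]] by fastforce
next
  case (add u v)
  then show ?case using relations_add[OF relations_left[of u v 1] relations_add] by fastforce
qed

text \<open>This identifies \<open>W\<^sub>\<psi>\<close> with the quotient of \<open>U(sv)\<close> by the left ideal generated by \<open>sv\<^sup>+\<close>; from
  here on all computations take place in \<open>U(sv)\<close> modulo this ideal.\<close>

lemma pure_eq_iff_left_ideal: "pure u = pure v \<longleftrightarrow> u - v \<in> plus_left_ideal"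
proof
  assume "pure u = pure v"
  then have rel: "frag_of (u, 1) - frag_of (v, 1) \<in> relations" by (simp add: pure_eq_iff)
  have "coeff B (u - v) = 0" if "nonpositive B" for B
  proof -
    have "frag_sum (\<lambda>(m, n). n * coeff B m) (frag_of (u, 1) - frag_of (v, 1)) = 0"
      using rel
      by (rule frag_sum_tensor_relators[rotated 3])
        (simp_all add: coeff_add distrib_left distrib_right coeff_balanced[OF that])
    then show ?thesis by (simp add: frag_sum_diff coeff_diff)
  qed
  then show "u - v \<in> plus_left_ideal" by (simp add: plus_left_ideal_def)
next
  assume "u - v \<in> plus_left_ideal"
  then have "frag_of (u - v, 1) \<in> relations" by (rule plus_left_ideal_relations)
  then have "frag_of (u - v + v, 1) - frag_of (u - v, 1) - frag_of (v, 1) + frag_of (u - v, 1) \<in> relations"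
    by (intro relations_add[OF relations_left])
  then show "pure u = pure v" by (simp add: pure_eq_iff)
qed

lemma whittaker_vectors_eq:
  "whittaker_vectors \<psi> = {pure u | u. \<forall>p. positive p \<longrightarrow> gen p * u \<in> plus_left_ideal}"
proof -
  have scale: "W_scale \<psi> (\<psi> x) (pure u) = pure 0" for x u
    by (simp add: W_scale_def W_act_pure_one trivial)
  have killed: "(\<forall>x. W_act \<psi> (uea_of (sv_incl x)) (pure u) = W_scale \<psi> (\<psi> x) (pure u))
      \<longleftrightarrow> (\<forall>p. positive p \<longrightarrow> gen p * u \<in> plus_left_ideal)" for u
  proof -
    have "(\<forall>x. W_act \<psi> (uea_of (sv_incl x)) (pure u) = W_scale \<psi> (\<psi> x) (pure u))
        \<longleftrightarrow> (\<forall>x. uea_of (sv_incl x) * u \<in> plus_left_ideal)"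
      by (simp add: scale W_act_pure_one pure_eq_iff_left_ideal)
    also have "\<dots> \<longleftrightarrow> (\<forall>p. positive p \<longrightarrow> gen p * u \<in> plus_left_ideal)"
    proof (intro iffI allI impI)
      fix p assume x: "\<forall>x. uea_of (sv_incl x) * u \<in> plus_left_ideal" and "positive p"
      have "sv_incl (Abs_sv_plus (sv_basis p)) = sv_basis p"
        by (rule Abs_sv_plus_inverse) (rule positive_sv_plus[OF \<open>positive p\<close>])
      then show "gen p * u \<in> plus_left_ideal"
        using x[rule_format, of "Abs_sv_plus (sv_basis p)"] by simp
    next
      fix x assume p: "\<forall>p. positive p \<longrightarrow> gen p * u \<in> plus_left_ideal"
      have "uea_of y * u \<in> plus_left_ideal" if "y \<in> cvec.span sv_plus_basis" for y
        using that
      proof (induction rule: cvec.span_induct_alt)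
        case base
        show ?case by (simp add: clinear_zero[OF sv.clinear_uea_of] plus_left_ideal_zero)
      next
        case (step c y z)
        then obtain i where "y = sv_basis i" "positive i" by fastforce
        with step p show ?case
          by (simp add: clinear_add[OF sv.clinear_uea_of] clinear_cscale[OF sv.clinear_uea_of]
              distrib_right cscale_mult_left plus_left_ideal_add plus_left_ideal_cscale)
      qed
      then show "uea_of (sv_incl x) * u \<in> plus_left_ideal" using sv_incl by blast
    qed
    finally show ?thesis .
  qed
  show ?thesis
  proof (intro set_eqI iffI)
    fix v assume v: "v \<in> whittaker_vectors \<psi>"
    then have "v \<in> W \<psi>" by (simp add: whittaker_vectors_def)
    then obtain u where u: "v = pure u" by (rule W_elem_pure)
    have "\<forall>p. positive p \<longrightarrow> gen p * u \<in> plus_left_ideal"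
      using v unfolding u whittaker_vectors_def mem_Collect_eq killed by (rule conjunct2)
    then show "v \<in> {pure u | u. \<forall>p. positive p \<longrightarrow> gen p * u \<in> plus_left_ideal}" using u by blast
  next
    fix v assume "v \<in> {pure u | u. \<forall>p. positive p \<longrightarrow> gen p * u \<in> plus_left_ideal}"
    then obtain u where u: "v = pure u" and p: "\<forall>p. positive p \<longrightarrow> gen p * u \<in> plus_left_ideal" by blast
    show "v \<in> whittaker_vectors \<psi>"
      unfolding u whittaker_vectors_def mem_Collect_eq killed using pure_in_W p by (rule conjI)
  qed
qed

end


section \<open>Lowering operators on ordered monomials\<close>

lemma gen_commute: "gen i * gen j = gen j * gen i + uea_of (basis_bracket i j)"
  using lie_to_alg_hom_uea_of[where 'a = sv] sv_lie_bracket_basis[of i j]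
  unfolding lie_to_alg_hom_def by (metis add_diff_cancel_left' diff_add_cancel add.commute)

lemma gen_monom_Cons: "gen q * monom (y # x) = gen y * (gen q * monom x) + uea_of (basis_bracket q y) * monom x"
  using gen_commute[of q y] by (simp add: monom_Cons distrib_right flip: mult.assoc)

lemmas uea_of_linear = clinear_add[OF sv.clinear_uea_of] clinear_cscale[OF sv.clinear_uea_of]
  clinear_zero[OF sv.clinear_uea_of] clinear_minus[OF sv.clinear_uea_of]

lemma central_M0: "basis_bracket (M 0) y = 0" "basis_bracket y (M 0) = 0"
  by (cases y; simp)+

lemma monom_M0_Cons: "gen y * monom (M 0 # x) = monom (M 0 # y # x)"
  using gen_monom_Cons[of y "M 0" x] by (simp add: central_M0 uea_of_linear monom_Cons)

text \<open>Moving a positive generator to the right past \<open>M\<^sub>0\<close> or \<open>L\<^sub>0\<close> only reproduces multiples of the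
  same generator.\<close>

lemma positive_kills_Cartan:
  assumes "positive p" "set x \<subseteq> {M 0, L 0}"
  shows "gen p * monom x \<in> plus_left_ideal"
  using assms(2)
proof (induction x)
  case Nil
  show ?case using plus_left_ideal_gen[OF assms(1), of 1] by simp
next
  case (Cons y x)
  have "\<exists>c. basis_bracket p y = cscale c (sv_basis p)"
  proof (cases "y = M 0")
    case True
    then show ?thesis by (intro exI[of _ 0]) (simp add: central_M0)
  next
    case False
    with Cons.prems have "y = L 0" by simp
    then show ?thesis by (cases p) (auto simp flip: cvec.scale_minus_left)
  qed
  then obtain c where "basis_bracket p y = cscale c (sv_basis p)" by blast
  with Cons show ?case
    by (simp add: gen_monom_Cons uea_of_linear cscale_mult_left plus_left_ideal_add plus_left_ideal_mult
        plus_left_ideal_cscale)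
qed

text \<open>In the module these are the combinations of words of weight below \<open>t\<close>. The error terms that
  occur below have \<open>t = word_weight x - 1\<close>, which may be negative, so \<open>t\<close> is an integer; for
  \<open>t \<le> 0\<close> nothing but the left ideal is left.\<close>

definition filtration :: "int \<Rightarrow> sv uea set"
  where "filtration t = cvec.span (plus_left_ideal \<union> {monom w | w. word_weight w < t})"

lemma filtration_add: "u \<in> filtration t \<Longrightarrow> v \<in> filtration t \<Longrightarrow> u + v \<in> filtration t"
  and filtration_cscale: "u \<in> filtration t \<Longrightarrow> cscale c u \<in> filtration t"
  and filtration_zero: "0 \<in> filtration t"
  by (simp_all add: filtration_def cvec.span_add cvec.span_scale cvec.span_zero)

lemma filtration_ideal: "u \<in> plus_left_ideal \<Longrightarrow> u \<in> filtration t"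
  and filtration_monom: "word_weight w < t \<Longrightarrow> monom w \<in> filtration t"
  by (auto simp: filtration_def intro: cvec.span_base)

lemma filtration_mono: "s \<le> t \<Longrightarrow> filtration s \<subseteq> filtration t"
  unfolding filtration_def by (rule cvec.span_mono) auto

lemma filtration_induct [consumes 1, case_names ideal monom zero scale_add]:
  assumes "u \<in> filtration t"
    and "\<And>u. u \<in> plus_left_ideal \<Longrightarrow> P u" "\<And>w. word_weight w < t \<Longrightarrow> P (monom w)"
    and "P 0" "\<And>c u v. P u \<Longrightarrow> P v \<Longrightarrow> P (cscale c u + v)"
  shows "P u"
  using assms(1) unfolding filtration_def
  by (induction rule: cvec.span_induct_alt) (auto intro: assms(2-5))

lemma filtration_nonpos:
  assumes "t \<le> 0" "u \<in> filtration t"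
  shows "u \<in> plus_left_ideal"
  using assms(2)
proof (induction rule: filtration_induct)
  case (monom w)
  then show ?case using assms(1) word_weight_nonneg[of w] by simp
qed (simp_all add: plus_left_ideal_zero plus_left_ideal_add plus_left_ideal_cscale)

lemma filtration_gen:
  assumes "u \<in> filtration t"
  shows "gen y * u \<in> filtration (t + weight y)"
  using assms
proof (induction rule: filtration_induct)
  case (ideal u)
  then show ?case by (intro filtration_ideal plus_left_ideal_mult)
next
  case (monom w)
  then show ?case using filtration_monom[of "y # w"] by (simp add: monom_Cons)
next
  case (scale_add c u v)
  then show ?case by (simp add: distrib_left cscale_mult_right filtration_add filtration_cscale)
qed (simp add: filtration_zero)

lemma coeff_filtration:
  assumes "u \<in> filtration t" "nonpositive B" "t \<le> word_weight B"
  shows "coeff B u = 0"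
  using assms(1)
proof (induction rule: filtration_induct)
  case (monom w)
  then show ?case using assms(3) by (intro coeff_weight) simp
qed (use assms(2) in \<open>simp_all add: plus_left_ideal_def coeff_zero coeff_add coeff_cscale\<close>)

text \<open>On its way to the right, \<open>M\<^sub>k\<close> either passes all letters and is killed, or is turned by some
  \<open>L\<^sub>j\<close> with \<open>j < 0\<close> into another \<open>M\<close>, which uses up this letter. The \<open>L\<^sub>j\<close> with \<open>j \<ge> 0\<close> keep the index
  of \<open>M\<close> positive, hence the generalization over \<open>k\<close>.\<close>

lemma M_lowers_filtration:
  assumes "k \<ge> 1"
  shows "gen (M k) * monom x \<in> filtration (word_weight x)"
  using assms
proof (induction x arbitrary: k)
  case Nil
  then show ?case using plus_left_ideal_gen[of "M k" 1] by (intro filtration_ideal) simp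
next
  case (Cons y x)
  have "gen y * (gen (M k) * monom x) \<in> filtration (word_weight (y # x))"
    using filtration_gen[OF Cons.IH[OF Cons.prems], of y] by (simp add: add.commute)
  moreover have "uea_of (basis_bracket (M k) y) * monom x \<in> filtration (word_weight (y # x))"
  proof (cases y)
    case (L j)
    have "gen (M (j + k)) * monom x \<in> filtration (word_weight (y # x))"
    proof (cases "j < 0")
      case True
      then show ?thesis using filtration_monom[of "M (j + k) # x"] L by (simp add: monom_Cons)
    next
      case False
      then show ?thesis using Cons.IH[of "j + k"] Cons.prems L by simp
    qed
    then show ?thesis
      using L filtration_cscale[where c = "- of_int k"] by (simp add: uea_of_linear cscale_mult_left)
  qed (simp_all add: uea_of_linear filtration_zero)
  ultimately show ?case by (simp add: gen_monom_Cons filtration_add)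
qed

text \<open>The possible effects of a positive generator \<open>q\<close> on a letter \<open>y\<close> when \<open>q\<close> is to act as the
  derivative with respect to the letter \<open>p\<close>, scaled by \<open>d M\<^sub>0\<close>: the bracket is the central
  \<open>d M\<^sub>0\<close> for \<open>y = p\<close>, and otherwise it is zero or an error term \<open>c M\<^sub>k\<close> with \<open>k \<ge> 1\<close>. Error terms
  are admitted only under the condition \<open>err\<close>. The letter \<open>L\<^sub>0\<close> is exempt because it stands at the end of an
  ordered monomial.\<close>

definition lowers_onto :: "sv_index \<Rightarrow> sv_index \<Rightarrow> complex \<Rightarrow> sv_index \<Rightarrow> bool \<Rightarrow> bool"
  where "lowers_onto q p d y err \<longleftrightarrow> y = L 0
    \<or> basis_bracket q y = (if y = p then cscale d (sv_basis (M 0)) else 0)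
    \<or> y \<noteq> p \<and> err \<and> (\<exists>c k. k \<ge> 1 \<and> basis_bracket q y = cscale c (sv_basis (M k)))"

lemma L0_maximal: "\<not> positive i \<Longrightarrow> L 0 \<le> i \<Longrightarrow> i = L 0"
  by (cases i) (auto simp: less_eq_sv_index_def split: if_splits)

text \<open>The generator \<open>q\<close> is moved to the right. Each occurrence of \<open>p\<close> contributes the monomial with
  that occurrence replaced by the central \<open>M\<^sub>0\<close>. An error term \<open>M\<^sub>k\<close> has replaced a letter of weight
  one, and by \<open>M_lowers_filtration\<close> it lowers the weight once more; if the whole monomial has weight zero,
  it is killed. So the error is one weight below the main term when \<open>p\<close> has weight one, and it
  is zero when the monomial has weight zero.\<close>

lemma lowering_formula:
  assumes q: "positive q" and p: "p \<noteq> L 0"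
    and "sorted x" "nonpositive x" "\<And>y. y \<in> set x \<Longrightarrow> lowers_onto q p d y (weight y = 1 \<or> word_weight x = 0)"
  shows "gen q * monom x - cscale (d * of_nat (count_list x p)) (monom (M 0 # remove1 p x))
    \<in> filtration (word_weight x - 1)"
  using assms(3-)
proof (induction x)
  case Nil
  show ?case using plus_left_ideal_gen[OF q, of 1] by (intro filtration_ideal) simp
next
  case (Cons y x)
  let ?main = "\<lambda>x. cscale (d * of_nat (count_list x p)) (monom (M 0 # remove1 p x))"
  let ?F = "filtration (word_weight (y # x) - 1)"
  show ?case
  proof (cases "y = L 0")
    case True
    have "z = L 0" if "z \<in> set x" for z
      using that Cons.prems(1,2) True by (intro L0_maximal) auto
    then have "set (y # x) \<subseteq> {M 0, L 0}" and "p \<notin> set (y # x)" using True p by auto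
    moreover from this(2) have "count_list (y # x) p = 0" by (simp add: count_list_0_iff del: count_list.simps)
    ultimately show ?thesis
      using positive_kills_Cartan[OF q, of "y # x"]
      by (simp only: of_nat_0 mult_zero_right cvec.scale_zero_left diff_zero filtration_ideal)
  next
    case False
    \<comment> \<open>for the condition on error terms to be inherited by the tail\<close>
    have zero: "word_weight x = 0" if "word_weight (y # x) = 0"
      using that weight_nonneg[of y] word_weight_nonneg[of x] by simp
    have "gen q * monom x - ?main x \<in> filtration (word_weight x - 1)"
    proof (rule Cons.IH)
      show "lowers_onto q p d z (weight z = 1 \<or> word_weight x = 0)" if "z \<in> set x" for z
        using Cons.prems(3)[of z] that zero unfolding lowers_onto_def by auto
    qed (use Cons.prems in auto)
    then have "gen y * (gen q * monom x - ?main x) \<in> filtration (word_weight x - 1 + weight y)"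
      by (rule filtration_gen)
    moreover have "word_weight x - 1 + weight y = word_weight (y # x) - 1" by simp
    ultimately have "gen y * (gen q * monom x - ?main x) \<in> ?F" by (simp only:)
    then have IH: "gen y * (gen q * monom x)
        - cscale (d * of_nat (count_list x p)) (monom (M 0 # y # remove1 p x)) \<in> ?F"
      by (simp add: right_diff_distrib cscale_mult_right monom_M0_Cons)
    consider (target) "y = p" "basis_bracket q y = cscale d (sv_basis (M 0))"
      | (commute) "y \<noteq> p" "basis_bracket q y = 0"
      | (error) c k where "y \<noteq> p" "weight y = 1 \<or> word_weight (y # x) = 0" "k \<ge> 1"
          "basis_bracket q y = cscale c (sv_basis (M k))"
      using Cons.prems(3)[of y] False unfolding lowers_onto_def by (cases "y = p") auto
    then show ?thesis
    proof cases
      case target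
      \<comment> \<open>in an ordered word a further occurrence of p follows immediately\<close>
      have "cscale (d * of_nat (count_list x p)) (monom (M 0 # y # remove1 p x))
          = cscale (d * of_nat (count_list x p)) (monom (M 0 # x))"
      proof (cases "p \<in> set x")
        case True
        then obtain x' where "x = p # x'"
          using Cons.prems(1) target(1) by (cases x) (force dest: antisym)+
        then show ?thesis using target(1) by simp
      next
        case False
        then show ?thesis by (simp add: count_list_0_iff)
      qed
      moreover have "gen q * monom (y # x) = gen y * (gen q * monom x) + cscale d (monom (M 0 # x))"
        by (simp only: gen_monom_Cons target(2) uea_of_linear cscale_mult_left monom_Cons[of "M 0" x])
      moreover have "?main (y # x)
          = cscale (d * of_nat (count_list x p)) (monom (M 0 # x)) + cscale d (monom (M 0 # x))"
        using target(1) by (simp add: distrib_left cscale_add_left add.commute)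
      ultimately show ?thesis using IH by (simp only: add_diff_cancel_right)
    next
      case commute
      with IH show ?thesis by (simp add: gen_monom_Cons uea_of_linear)
    next
      case error
      have Mk: "gen (M k) * monom x \<in> filtration (word_weight x)"
        using error(3) by (rule M_lowers_filtration)
      have "gen (M k) * monom x \<in> ?F"
      proof (cases "weight y = 1")
        case False
        then have "word_weight x \<le> 0" using error(2) zero by simp
        then show ?thesis using filtration_nonpos[OF _ Mk] by (intro filtration_ideal)
      qed (use Mk in simp)
      then have "uea_of (basis_bracket q y) * monom x \<in> ?F"
        by (simp add: error(4) uea_of_linear cscale_mult_left filtration_cscale)
      from filtration_add[OF IH this] error(1) show ?thesis
        by (simp add: gen_monom_Cons algebra_simps)
    qed
  qed
qed

lemma M0_minimal: "M 0 \<le> i"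
  by (cases i) (auto simp: less_eq_sv_index_def)

lemma weight_le_one: "weight i \<le> 1"
  by (cases i) auto

text \<open>If \<open>p\<close> occurred in a word \<open>w0\<close> of top weight \<open>K\<close>, then \<open>q\<close> applied to the whole element would
  have a nonzero coordinate at the word \<open>B\<close> obtained from \<open>w0\<close> by replacing one \<open>p\<close> by \<open>M\<^sub>0\<close>: the
  derivative is injective on the words containing \<open>p\<close>, so no other word of weight \<open>K\<close> contributes to \<open>B\<close>,
  and the error terms and the words of lower weight only yield weights below \<open>K - 1\<close>.\<close>

lemma singular_avoids:
  fixes f :: "sv_index free_alg"
  assumes q: "positive q" and p: "p \<noteq> L 0" and "d \<noteq> 0"
    and words: "\<And>w. Word w \<in> Poly_Mapping.keys f \<Longrightarrow> sorted w \<and> nonpositive w \<and> word_weight w \<le> K"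
    and top: "\<And>w y. Word w \<in> Poly_Mapping.keys f \<Longrightarrow> word_weight w = K \<Longrightarrow> y \<in> set w
      \<Longrightarrow> lowers_onto q p d y (weight y = 1 \<or> K = 0)"
    and lower: "\<And>w. Word w \<in> Poly_Mapping.keys f \<Longrightarrow> word_weight w < K
      \<Longrightarrow> gen q * monom w \<in> filtration (K - 1)"
    and killed: "gen q * sv.basis_eval f \<in> plus_left_ideal"
    and w0: "Word w0 \<in> Poly_Mapping.keys f" "word_weight w0 = K"
  shows "p \<notin> set w0"
proof
  assume "p \<in> set w0"
  define B where "B = M 0 # remove1 p w0"
  have word_weight_remove1: "word_weight (remove1 z w) = word_weight w - weight z" if "z \<in> set w" for z w
    using that by (induction w) auto
  have B: "sorted B" "nonpositive B" "K - 1 \<le> word_weight B"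
    using words[OF w0(1)] w0(2) \<open>p \<in> set w0\<close> M0_minimal weight_le_one[of p]
    by (auto simp: B_def sorted_remove1 word_weight_remove1 dest: set_remove1_subset[THEN subsetD])
  have coeff_word: "coeff B (gen q * monom w) = (if w = w0 then d * of_nat (count_list w0 p) else 0)"
    if w: "Word w \<in> Poly_Mapping.keys f" for w
  proof (cases "word_weight w = K")
    case False
    then have "coeff B (gen q * monom w) = 0"
      using lower[OF w] words[OF w] B by (intro coeff_filtration[of _ "K - 1"]) auto
    then show ?thesis using False w0(2) by auto
  next
    case True
    let ?main = "cscale (d * of_nat (count_list w p)) (monom (M 0 # remove1 p w))"
    have "gen q * monom w - ?main \<in> filtration (word_weight w - 1)"
      using words[OF w] top[OF w True] True by (intro lowering_formula q p) auto
    then have "coeff B (gen q * monom w - ?main) = 0"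
      using B True by (intro coeff_filtration) auto
    then have "coeff B (gen q * monom w) = coeff B ?main" unfolding coeff_diff by simp
    also have "\<dots> = (if M 0 # remove1 p w = B then d * of_nat (count_list w p) else 0)"
      using words[OF w] M0_minimal
      by (subst coeff_cscale, subst coeff_monom_sorted) (auto simp: sorted_remove1)
    also have "\<dots> = (if w = w0 then d * of_nat (count_list w0 p) else 0)"
    proof (cases "p \<in> set w \<and> remove1 p w = remove1 p w0")
      case True
      have "sorted w" "sorted w0" using words[OF w] words[OF w0(1)] by blast+
      have "insort p (remove1 p w) = w" using True \<open>sorted w\<close> by (blast intro: insort_remove1)
      moreover have "insort p (remove1 p w0) = w0"
        using \<open>p \<in> set w0\<close> \<open>sorted w0\<close> by (rule insort_remove1)
      ultimately have "w = w0" using True by metis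
      then show ?thesis by (simp add: B_def)
    next
      case False
      then show ?thesis using \<open>p \<in> set w0\<close> by (auto simp: B_def count_list_0_iff)
    qed
    finally show ?thesis .
  qed
  have "sv.basis_eval f = (\<Sum>z\<in>Poly_Mapping.keys f. cscale (Poly_Mapping.lookup f z) (monom (letters z)))"
    by (subst mon_expansion) (simp add: clinear_sum[OF sv.clinear_basis_eval])
  then have "coeff B (gen q * sv.basis_eval f)
      = (\<Sum>z\<in>Poly_Mapping.keys f. Poly_Mapping.lookup f z * coeff B (gen q * monom (letters z)))"
    by (simp add: sum_distrib_left coeff_sum cscale_mult_right coeff_cscale)
  also have "\<dots> = (\<Sum>z\<in>Poly_Mapping.keys f. if z = Word w0 then Poly_Mapping.lookup f (Word w0) * (d * of_nat (count_list w0 p)) else 0)"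
  proof (rule sum.cong)
    fix z assume "z \<in> Poly_Mapping.keys f"
    moreover obtain w where "z = Word w" by (cases z)
    ultimately show "Poly_Mapping.lookup f z * coeff B (gen q * monom (letters z))
      = (if z = Word w0 then Poly_Mapping.lookup f (Word w0) * (d * of_nat (count_list w0 p)) else 0)"
      using coeff_word[of w] by auto
  qed simp
  also have "\<dots> = Poly_Mapping.lookup f (Word w0) * (d * of_nat (count_list w0 p))"
    using w0(1) by simp
  also have "\<dots> \<noteq> 0"
    using w0(1) \<open>d \<noteq> 0\<close> \<open>p \<in> set w0\<close> by (simp add: in_keys_iff count_list_0_iff)
  finally show False using killed B(2) by (simp add: plus_left_ideal_def)
qed


section \<open>Singular vectors\<close>

text \<open>Suppose that the top weight \<open>K\<close> is positive, and let \<open>L\<^bsub>-n\<^esub>\<close> be the letter with the largest \<open>n\<close> in the words of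
  weight \<open>K\<close>. Then \<open>M\<^sub>n\<close> acts on these words as \<open>- n M\<^sub>0\<close> times the derivative with respect to
  \<open>L\<^bsub>-n\<^esub>\<close>, up to lower weight, because its bracket with any other \<open>L\<^sub>j\<close> is a multiple of \<open>M\<^bsub>j+n\<^esub>\<close> with \<open>j + n \<ge> 1\<close>.\<close>

lemma singular_weight_zero:
  fixes f :: "sv_index free_alg"
  assumes words: "\<And>w. Word w \<in> Poly_Mapping.keys f \<Longrightarrow> sorted w \<and> nonpositive w"
    and killed: "\<And>q. positive q \<Longrightarrow> gen q * sv.basis_eval f \<in> plus_left_ideal"
    and "Word w \<in> Poly_Mapping.keys f"
  shows "word_weight w = 0"
proof (rule ccontr)
  assume "word_weight w \<noteq> 0"
  define K where "K = Max ((\<lambda>z. word_weight (letters z)) ` Poly_Mapping.keys f)"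
  have K: "word_weight v \<le> K" if "Word v \<in> Poly_Mapping.keys f" for v
    unfolding K_def using that by (intro Max_ge) (auto intro: rev_image_eqI)
  have "K \<ge> 1" using K[OF assms(3)] \<open>word_weight w \<noteq> 0\<close> word_weight_nonneg[of w] by linarith
  have "K \<in> (\<lambda>z. word_weight (letters z)) ` Poly_Mapping.keys f"
    unfolding K_def using assms(3) by (intro Max_in) auto
  then obtain z where z: "z \<in> Poly_Mapping.keys f" "K = word_weight (letters z)" by blast
  define v where "v = letters z"
  have v: "Word v \<in> Poly_Mapping.keys f" "word_weight v = K" using z by (simp_all add: v_def)
  define modes where "modes = {j. j < 0 \<and> (\<exists>w. Word w \<in> Poly_Mapping.keys f \<and> word_weight w = K \<and> L j \<in> set w)}"
  have "modes \<subseteq> mode ` (\<Union>z\<in>Poly_Mapping.keys f. set (letters z))"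
    unfolding modes_def by (force intro: rev_image_eqI)
  then have "finite modes" by (rule finite_subset) simp
  have "\<exists>j<0. L j \<in> set v"
  proof (rule ccontr)
    assume "\<not> ?thesis"
    then have "weight y = 0" if "y \<in> set v" for y using that by (cases y) auto
    then have "word_weight v = 0" by (simp add: sum_list_eq_0_iff cong: map_cong)
    then show False using v \<open>K \<ge> 1\<close> by simp
  qed
  then have "modes \<noteq> {}" using v unfolding modes_def by blast
  define n where "n = - Min modes"
  have "Min modes \<in> modes" using \<open>finite modes\<close> \<open>modes \<noteq> {}\<close> by (rule Min_in)
  then obtain w0 where n: "n \<ge> 1" and w0: "Word w0 \<in> Poly_Mapping.keys f" "word_weight w0 = K" "L (- n) \<in> set w0"
    by (auto simp: modes_def n_def)
  have "L (- n) \<notin> set w0"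
  proof (rule singular_avoids[of "M n" _ "- of_int n" f K])
    fix w y assume w: "Word w \<in> Poly_Mapping.keys f" "word_weight w = K" "y \<in> set w"
    show "lowers_onto (M n) (L (- n)) (- of_int n) y (weight y = 1 \<or> K = 0)"
    proof (cases y)
      case (L j)
      have "\<not> positive y" using words[OF w(1)] w(3) by blast
      then consider "j = 0" | "j = - n" | "j < 0" "j \<noteq> - n" using L by (force split: if_splits)
      then show ?thesis
      proof cases
        case 3
        then have "Min modes \<le> j" using w L \<open>finite modes\<close> by (intro Min_le) (auto simp: modes_def)
        then have "j + n \<ge> 1" using 3 by (simp add: n_def)
        moreover have "basis_bracket (M n) y = cscale (- of_int n) (sv_basis (M (j + n)))"
          using L by simp
        moreover have "weight y = 1" using 3 L by simp
        ultimately show ?thesis using 3 L unfolding lowers_onto_def by blast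
      qed (use L in \<open>simp_all add: lowers_onto_def\<close>)
    qed (simp_all add: lowers_onto_def)
  next
    fix w assume w: "Word w \<in> Poly_Mapping.keys f" "word_weight w < K"
    then show "gen (M n) * monom w \<in> filtration (K - 1)"
      using M_lowers_filtration[OF n, of w] filtration_mono[of "word_weight w" "K - 1"] by auto
  qed (use n words K w0 killed in auto)
  with w0 show False by blast
qed

text \<open>Once no \<open>L\<^sub>j\<close> with \<open>j < 0\<close> is left, all words have weight zero and there are no errors. If \<open>Y\<^sub>n\<close>
  is the letter with the least mode among the \<open>Y\<close> (it stands for the index \<open>n + 1/2\<close>), then \<open>Y\<^bsub>-n-1\<^esub>\<close> acts as
  \<open>(2 n + 1) M\<^sub>0\<close> times the derivative with respect to it, so there is no \<open>Y\<close>. If then \<open>M\<^sub>n\<close> with \<open>n < 0\<close>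
  has the least mode among the \<open>M\<close>, then \<open>L\<^bsub>-n\<^esub>\<close> acts as \<open>n M\<^sub>0\<close> times the derivative
  with respect to it, so there is no such \<open>M\<close> either.\<close>

lemma singular_Cartan:
  fixes f :: "sv_index free_alg"
  assumes words: "\<And>w. Word w \<in> Poly_Mapping.keys f \<Longrightarrow> sorted w \<and> nonpositive w"
    and killed: "\<And>q. positive q \<Longrightarrow> gen q * sv.basis_eval f \<in> plus_left_ideal"
    and "Word w \<in> Poly_Mapping.keys f"
  shows "set w \<subseteq> {M 0, L 0}"
proof -
  define letters_of where "letters_of = (\<Union>z\<in>Poly_Mapping.keys f. set (letters z))"
  have fin: "finite letters_of" by (simp add: letters_of_def)
  have in_letters: "y \<in> letters_of" if "Word w \<in> Poly_Mapping.keys f" "y \<in> set w" for w y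
    using that by (force simp: letters_of_def)
  have from_letters: "\<exists>w. Word w \<in> Poly_Mapping.keys f \<and> y \<in> set w" if y: "y \<in> letters_of" for y
  proof -
    obtain z where "z \<in> Poly_Mapping.keys f" "y \<in> set (letters z)"
      using y unfolding letters_of_def by blast
    then show ?thesis by (intro exI[of _ "letters z"]) simp
  qed
  have nonpos: "\<not> positive y" if "y \<in> letters_of" for y
    using from_letters[OF that] words by blast
  have weight0: "word_weight w = 0" if "Word w \<in> Poly_Mapping.keys f" for w
    using singular_weight_zero[OF words killed that] .
  have L_zero: "j = 0" if L: "L j \<in> letters_of" for j
  proof -
    obtain w where w: "Word w \<in> Poly_Mapping.keys f" "L j \<in> set w" using from_letters[OF L] by blast
    have "weight (L j) \<le> word_weight w"
    proof (rule member_le_sum_list)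
      show "weight (L j) \<in> set (map weight w)" unfolding set_map using w(2) by (rule imageI)
    qed (auto simp: weight_nonneg)
    then show ?thesis using weight0[OF w(1)] nonpos[OF that] by (auto split: if_splits)
  qed
  have avoid: "p \<notin> letters_of" if "positive q" "p \<noteq> L 0" "d \<noteq> 0" "\<And>y. y \<in> letters_of \<Longrightarrow> lowers_onto q p d y True"
    for p q d
  proof
    assume "p \<in> letters_of"
    then obtain w0 where w0: "Word w0 \<in> Poly_Mapping.keys f" "p \<in> set w0" using from_letters by blast
    have "p \<notin> set w0"
    proof (rule singular_avoids[of q p d f 0])
      fix w y assume "Word w \<in> Poly_Mapping.keys f" "y \<in> set w"
      then show "lowers_onto q p d y (weight y = 1 \<or> 0 = (0::int))" using that(4) in_letters by simp
    qed (use that words weight0 killed w0 in auto)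
    with w0 show False by blast
  qed
  have Mode_fin: "finite {j. Y j \<in> letters_of}" "finite {j. M j \<in> letters_of}"
    using finite_vimageI[OF fin, of Y] finite_vimageI[OF fin, of M] by (auto simp: vimage_def inj_def)
  have no_Y: "Y j \<notin> letters_of" for j
  proof
    assume "Y j \<in> letters_of"
    define n where "n = Min {j. Y j \<in> letters_of}"
    have "Y n \<in> letters_of" using Min_in[OF Mode_fin(1)] \<open>Y j \<in> letters_of\<close> by (auto simp: n_def)
    then have "n < 0" using nonpos by (force split: if_splits)
    have "Y n \<notin> letters_of"
    proof (rule avoid[of "Y (- n - 1)" _ "of_int (2 * n + 1)"])
      show "of_int (2 * n + 1) \<noteq> (0::complex)" unfolding of_int_eq_0_iff by presburger
      fix y assume y: "y \<in> letters_of"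
      show "lowers_onto (Y (- n - 1)) (Y n) (of_int (2 * n + 1)) y True"
      proof (cases y)
        case (L j)
        then show ?thesis using L_zero y by (simp add: lowers_onto_def)
      next
        case (Y j)
        then have "n \<le> j" using y Mode_fin(1) by (simp add: n_def)
        show ?thesis
        proof (cases "j = n")
          case False
          then have "j - n \<ge> 1" using \<open>n \<le> j\<close> by simp
          moreover have "basis_bracket (Y (- n - 1)) y = cscale (of_int (j - (- n - 1))) (sv_basis (M (j - n)))"
            using Y by (simp add: algebra_simps)
          ultimately show ?thesis using Y False unfolding lowers_onto_def by blast
        qed (use Y in \<open>simp add: lowers_onto_def algebra_simps\<close>)
      qed (simp add: lowers_onto_def)
    qed (use \<open>n < 0\<close> in auto)
    with \<open>Y n \<in> letters_of\<close> show False by blast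
  qed
  have no_M: "j = 0" if "M j \<in> letters_of" for j
  proof (rule ccontr)
    assume "j \<noteq> 0"
    then have "j < 0" using nonpos[OF that] by (auto split: if_splits)
    define n where "n = Min {j. M j \<in> letters_of}"
    have "M n \<in> letters_of" using Min_in[OF Mode_fin(2)] that by (auto simp: n_def)
    have "n \<le> j" using that Mode_fin(2) by (simp add: n_def)
    then have "n < 0" using \<open>j < 0\<close> by simp
    have "M n \<notin> letters_of"
    proof (rule avoid[of "L (- n)" _ "of_int n"])
      fix y assume y: "y \<in> letters_of"
      show "lowers_onto (L (- n)) (M n) (of_int n) y True"
      proof (cases y)
        case (L j)
        then show ?thesis using L_zero y by (simp add: lowers_onto_def)
      next
        case (Y j)
        then show ?thesis using no_Y y by simp
      next
        case (M j)
        then have "n \<le> j" using y Mode_fin(2) by (simp add: n_def)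
        show ?thesis
        proof (cases "j = n")
          case False
          then have "- n + j \<ge> 1" using \<open>n \<le> j\<close> by simp
          moreover have "basis_bracket (L (- n)) y = cscale (of_int j) (sv_basis (M (- n + j)))"
            using M by simp
          ultimately show ?thesis using M False unfolding lowers_onto_def by blast
        qed (use M in \<open>simp add: lowers_onto_def\<close>)
      qed
    qed (use \<open>n < 0\<close> in auto)
    with \<open>M n \<in> letters_of\<close> show False by blast
  qed
  show ?thesis
  proof
    fix y assume "y \<in> set w"
    then have y: "y \<in> letters_of" using in_letters assms(3) by blast
    then show "y \<in> {M 0, L 0}" using L_zero no_Y no_M by (cases y) auto
  qed
qed

lemma L0_M0_subalgebra_eq:
  "L0_M0_subalgebra = {sv.basis_eval f | f. \<forall>w. Word w \<in> Poly_Mapping.keys f \<longrightarrow> set w \<subseteq> {M 0, L 0}}"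
    (is "_ = ?A")
proof
  let ?S = "{uea_of (sv_basis (L 0)), uea_of (sv_basis (M 0))}"
  show "L0_M0_subalgebra \<subseteq> ?A"
    unfolding L0_M0_subalgebra_def
  proof (rule hull_minimal)
    have "gen i \<in> ?A" if "i \<in> {L 0, M 0}" for i
    proof (intro CollectI exI[of _ "free_gen i"] conjI)
      show "\<forall>w. Word w \<in> Poly_Mapping.keys (free_gen i) \<longrightarrow> set w \<subseteq> {M 0, L 0}"
        using that by (auto simp: free_gen_def)
    qed simp
    then show "?S \<subseteq> ?A" by blast
    show "complex_subalgebra ?A"
      unfolding complex_subalgebra_def
    proof (intro conjI ballI allI)
      show "1 \<in> ?A"
      proof (intro CollectI exI[of _ 1] conjI)
        show "\<forall>w. Word w \<in> Poly_Mapping.keys (1 :: sv_index free_alg) \<longrightarrow> set w \<subseteq> {M 0, L 0}"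
          by (auto simp: zero_word_def simp flip: single_one)
      qed simp
      fix u assume "u \<in> ?A"
      then obtain f where f: "u = sv.basis_eval f" "\<forall>w. Word w \<in> Poly_Mapping.keys f \<longrightarrow> set w \<subseteq> {M 0, L 0}"
        by blast
      show "cscale c u \<in> ?A" for c
        using f by (intro CollectI exI[of _ "cscale c f"])
          (auto simp: in_keys_iff lookup_cscale cscale_complex_def)
      fix v assume "v \<in> ?A"
      then obtain g where g: "v = sv.basis_eval g" "\<forall>w. Word w \<in> Poly_Mapping.keys g \<longrightarrow> set w \<subseteq> {M 0, L 0}"
        by blast
      show "u + v \<in> ?A"
        using f g Poly_Mapping.keys_add[of f g] by (intro CollectI exI[of _ "f + g"]) auto
      have "set w \<subseteq> {M 0, L 0}" if w: "Word w \<in> Poly_Mapping.keys (f * g)" for w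
      proof -
        obtain a b where "Word w = a + b" "a \<in> Poly_Mapping.keys f" "b \<in> Poly_Mapping.keys g"
          using w keys_mult[of f g] by blast
        then show ?thesis using f(2) g(2) by (cases a; cases b) (auto simp: plus_word_def)
      qed
      then show "u * v \<in> ?A"
        using f g by (intro CollectI exI[of _ "f * g"]) auto
    qed
  qed
  have hull: "complex_subalgebra L0_M0_subalgebra"
    unfolding L0_M0_subalgebra_def by (rule hull_in) (auto simp: complex_subalgebra_def)
  have gens: "gen (L 0) \<in> L0_M0_subalgebra" "gen (M 0) \<in> L0_M0_subalgebra"
    unfolding L0_M0_subalgebra_def by (rule hull_inc; simp)+
  have monoms: "monom w \<in> L0_M0_subalgebra" if "set w \<subseteq> {M 0, L 0}" for w
    using that hull gens by (induction w) (auto simp: monom_Cons complex_subalgebra_def)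
  show "?A \<subseteq> L0_M0_subalgebra"
  proof
    fix u assume "u \<in> ?A"
    then obtain f where f: "u = sv.basis_eval f" "\<forall>w. Word w \<in> Poly_Mapping.keys f \<longrightarrow> set w \<subseteq> {M 0, L 0}"
      by blast
    have scaled: "cscale c u \<in> L0_M0_subalgebra" if "u \<in> L0_M0_subalgebra" for c u
      using that hull by (simp add: complex_subalgebra_def)
    have zero: "0 \<in> L0_M0_subalgebra" using scaled[OF gens(1), of 0] by simp
    have "(\<Sum>z\<in>A. cscale (Poly_Mapping.lookup f z) (monom (letters z))) \<in> L0_M0_subalgebra"
      if "A \<subseteq> Poly_Mapping.keys f" for A
      using finite_subset[OF that finite_keys] that
    proof (induction A rule: finite_induct)
      case (insert z A)
      then have "monom (letters z) \<in> L0_M0_subalgebra" using f(2) by (intro monoms) auto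
      with insert show ?case using scaled hull by (auto simp: complex_subalgebra_def)
    qed (simp add: zero)
    from this[of "Poly_Mapping.keys f"] show "u \<in> L0_M0_subalgebra"
      unfolding f(1) by (subst mon_expansion) (simp add: clinear_sum[OF sv.clinear_basis_eval])
  qed
qed

lemma L0_M0_singular:
  assumes "u \<in> L0_M0_subalgebra" "positive q"
  shows "gen q * u \<in> plus_left_ideal"
proof -
  obtain f where f: "u = sv.basis_eval f" "\<forall>w. Word w \<in> Poly_Mapping.keys f \<longrightarrow> set w \<subseteq> {M 0, L 0}"
    using assms(1) unfolding L0_M0_subalgebra_eq by blast
  have "(\<Sum>z\<in>A. cscale (Poly_Mapping.lookup f z) (gen q * monom (letters z))) \<in> plus_left_ideal"
    if "A \<subseteq> Poly_Mapping.keys f" for A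
    using finite_subset[OF that finite_keys] that
  proof (induction A rule: finite_induct)
    case (insert z A)
    then have "gen q * monom (letters z) \<in> plus_left_ideal"
      using f(2) by (intro positive_kills_Cartan assms(2)) auto
    with insert show ?case by (simp add: plus_left_ideal_add plus_left_ideal_cscale)
  qed (simp add: plus_left_ideal_zero)
  from this[of "Poly_Mapping.keys f"] show ?thesis
    unfolding f(1)
    by (subst mon_expansion) (simp add: clinear_sum[OF sv.clinear_basis_eval] sum_distrib_left cscale_mult_right)
qed

text \<open>The representative keeps the part of the PBW expansion in nonpositive words.\<close>

lemma nonpositive_representative:
  obtains f where "u - sv.basis_eval f \<in> plus_left_ideal"
    and "\<And>w. Word w \<in> Poly_Mapping.keys f \<Longrightarrow> sorted w \<and> nonpositive w"
proof -
  let ?p = "sv.pbw_coords u"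
  define f where "f = (\<Sum>z\<in>{z \<in> Poly_Mapping.keys ?p. nonpositive (letters z)}.
    cscale (Poly_Mapping.lookup ?p z) (mon (letters z)))"
  have lookup_f: "Poly_Mapping.lookup f (Word w) = (if nonpositive w then Poly_Mapping.lookup ?p (Word w) else 0)" for w
  proof -
    have "Poly_Mapping.lookup f (Word w) = (\<Sum>z\<in>{z \<in> Poly_Mapping.keys ?p. nonpositive (letters z)}.
        if z = Word w then Poly_Mapping.lookup ?p z else 0)"
      unfolding f_def
      by (simp add: lookup_sum lookup_cscale mon_def lookup_single cscale_complex_def when_def if_distrib cong: if_cong)
    then show ?thesis by (simp add: in_keys_iff)
  qed
  have words: "sorted w \<and> nonpositive w" if "Word w \<in> Poly_Mapping.keys f" for w
  proof -
    have "Word w \<in> Poly_Mapping.keys ?p" "nonpositive w"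
      using that by (auto simp: in_keys_iff lookup_f split: if_splits)
    then show ?thesis using sv.keys_pbw_coords[of u] by auto
  qed
  have "sv.pbw_coords (sv.basis_eval f) = f"
  proof -
    have "sv.normal_form f = lin_ext mon f"
      unfolding lin_ext_def
    proof (rule sum.cong)
      fix z assume "z \<in> Poly_Mapping.keys f"
      then show "cscale (Poly_Mapping.lookup f z) (sv.sort_word (letters z))
          = cscale (Poly_Mapping.lookup f z) (mon (letters z))"
        using words[of "letters z"] by (simp add: sv.sort_word_sorted)
    qed simp
    then show ?thesis by (simp add: sv.pbw_coords_basis_eval lin_ext_def flip: mon_expansion)
  qed
  then have "coeff B (u - sv.basis_eval f) = 0" if "nonpositive B" for B
    unfolding coeff_diff using that lookup_f[of B] by (simp add: coeff_def)
  then have "u - sv.basis_eval f \<in> plus_left_ideal" by (simp add: plus_left_ideal_def)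
  then show ?thesis using words by (rule that)
qed

theorem theorem5p4:
  fixes \<psi> :: "sv_plus \<Rightarrow> complex"
  assumes "lie_hom \<psi>"
    and "\<forall>x. \<psi> x = 0"
  shows "whittaker_vectors \<psi> = {W_act \<psi> p (W_gen \<psi>) | p. p \<in> L0_M0_subalgebra}"
proof -
  interpret trivial_whittaker \<psi> using assms(2) by unfold_locales blast
  have orbit: "W_act \<psi> p (W_gen \<psi>) = pure p" for p
    using W_act_pure_one[of p 1] by (simp add: W_gen_def)
  show ?thesis
  proof (intro set_eqI iffI)
    fix v assume "v \<in> whittaker_vectors \<psi>"
    then obtain u where v: "v = pure u" and u: "\<And>q. positive q \<Longrightarrow> gen q * u \<in> plus_left_ideal"
      unfolding whittaker_vectors_eq by blast
    obtain f where f: "u - sv.basis_eval f \<in> plus_left_ideal"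
      and words: "\<And>w. Word w \<in> Poly_Mapping.keys f \<Longrightarrow> sorted w \<and> nonpositive w"
      using nonpositive_representative[of u] by blast
    have killed: "gen q * sv.basis_eval f \<in> plus_left_ideal" if "positive q" for q
      using plus_left_ideal_diff[OF u[OF that] plus_left_ideal_mult[OF f, of "gen q"]]
      by (simp add: right_diff_distrib)
    have "sv.basis_eval f \<in> L0_M0_subalgebra"
      unfolding L0_M0_subalgebra_eq using singular_Cartan[OF words killed] by blast
    moreover have "v = pure (sv.basis_eval f)" using v f by (simp add: pure_eq_iff_left_ideal)
    ultimately show "v \<in> {W_act \<psi> p (W_gen \<psi>) | p. p \<in> L0_M0_subalgebra}"
      unfolding orbit by blast
  next
    fix v assume "v \<in> {W_act \<psi> p (W_gen \<psi>) | p. p \<in> L0_M0_subalgebra}"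
    then show "v \<in> whittaker_vectors \<psi>"
      unfolding orbit whittaker_vectors_eq using L0_M0_singular by blast
  qed
qed

end
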